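(* If $x\in\mathbb{R}^n$ is a point where $\psi$ is twice differentiable, then the transport maps $T_\tau$ are differentiable at $x$ for every $\tau\in[0,T]$, and, for every $s\in(0,T]$, it holds \begin{equation} \det(\nabla T_\tau(x))^{1/n}\geq\frac{\det(R_3(\tau-s))^{1/n}}{\det(R_3(-s))^{1/n}}+\frac{\det(R_3(\tau))^{1/n}}{\det(R_3(s))^{1/n}}\det(\nabla T_s(x))^{1/n},\qquad\forall \tau\in[0,s]. \end{equation} Moreover, both terms in the right hand side are non-negative for $\tau\in[0,s]$ and, for $\tau\in[0,s)$, the first one is positive. In particular, $\det(\nabla T_\tau(x))>0$ for all $\tau\in[0,T)$.
   Context: Let $n,m\in\mathbb{N}$, $m\leq n$, $A\in\mathbb{R}^{n\times n}$, $B\in\mathbb{R}^{n\times m}$ of rank $m$, $Q\in\mathbb{R}^{n\times n}$ symmetric, and let $(A,B,Q,T)$ be the LQ optimal control problem for $\dot x=Ax+Bu$ with cost $c=c^{0,T}$ given by the infimum of $\frac12\int_0^T(|u|^2-x^*Qx)\,d\tau$, satisfying the Kalman condition, with $T<t^*$ ($t^*$ the first conjugate time). Let $\Omega=\begin{pmatrix}\mathbb{0}_n & \mathbb{1}_n\\ -\mathbb{1}_n & \mathbb{0}_n\end{pmatrix}$, $H=\begin{pmatrix}BB^* & A\\ A^* & Q\end{pmatrix}$ and $e^{-\tau\Omega H}=\begin{pmatrix}R_1(\tau) & R_2(\tau)\\ R_3(\tau) & R_4(\tau)\end{pmatrix}$; the LQ exponential map is $\exp_{x,\tau}(p)=R_3(\tau)p+R_4(\tau)x$.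 Consider $\mu,\nu\in P_2(\mathbb{R}^n)$ with $\mu\ll\mathscr{L}^n$, and a ($c$-convex) Kantorovich potential $\psi$ for the LQ transport problem from $\mu$ to $\nu$. For $\tau\in[0,T]$, let $T_\tau(x)=\exp_{x,\tau}(\nabla\psi(x))$ be the optimal transport map from $\mu$ to the displacement interpolation $\mu_\tau$ for the cost $c^{0,\tau}$. *)

theory Defs
  imports "HOL-Analysis.Analysis" "HOL-Probability.Probability"
begin

section \<open>LQ optimal control data\<close>

text \<open>Kalman rank condition: the matrix [B, AB, ..., A^(n-1) B] has rank n,
  i.e. its columns span the whole state space.\<close>
definition kalman_condition :: "real^'n^'n \<Rightarrow> real^'m^'n \<Rightarrow> bool" where
  "kalman_condition A B \<longleftrightarrow>
     span (\<Union>k\<in>{..<CARD('n)}. range (\<lambda>v. (((*v) A) ^^ k) (B *v v))) = UNIV"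

text \<open>Omega and H as linear maps on R^n x R^n (first block p, second block x).\<close>
definition Omega_map :: "(real^'n) \<times> (real^'n) \<Rightarrow> (real^'n) \<times> (real^'n)" where
  "Omega_map z = (snd z, - fst z)"

definition H_map :: "real^'n^'n \<Rightarrow> real^'m^'n \<Rightarrow> real^'n^'n
    \<Rightarrow> (real^'n) \<times> (real^'n) \<Rightarrow> (real^'n) \<times> (real^'n)" where
  "H_map A B Q z = ((B ** transpose B) *v fst z + A *v snd z,
                    transpose A *v fst z + Q *v snd z)"

text \<open>The exponential e^{-tau Omega H} applied to a vector, as the exponential series.\<close>
definition ham_exp :: "real^'n^'n \<Rightarrow> real^'m^'n \<Rightarrow> real^'n^'n \<Rightarrow> real
    \<Rightarrow> (real^'n) \<times> (real^'n) \<Rightarrow> (real^'n) \<times> (real^'n)" where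
  "ham_exp A B Q \<tau> z =
     (\<Sum>k. (1 / fact k) *\<^sub>R (((\<lambda>w. (- \<tau>) *\<^sub>R Omega_map (H_map A B Q w)) ^^ k) z))"

text \<open>Lower blocks R_3 and R_4 of e^{-tau Omega H}.\<close>
definition R3 :: "real^'n^'n \<Rightarrow> real^'m^'n \<Rightarrow> real^'n^'n \<Rightarrow> real \<Rightarrow> real^'n^'n" where
  "R3 A B Q \<tau> = matrix (\<lambda>p. snd (ham_exp A B Q \<tau> (p, 0)))"

definition R4 :: "real^'n^'n \<Rightarrow> real^'m^'n \<Rightarrow> real^'n^'n \<Rightarrow> real \<Rightarrow> real^'n^'n" where
  "R4 A B Q \<tau> = matrix (\<lambda>x. snd (ham_exp A B Q \<tau> (0, x)))"

text \<open>LQ exponential map exp_{x,tau}(p) = R_3(tau) p + R_4(tau) x.\<close>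
definition LQ_exp :: "real^'n^'n \<Rightarrow> real^'m^'n \<Rightarrow> real^'n^'n \<Rightarrow> real^'n \<Rightarrow> real
    \<Rightarrow> real^'n \<Rightarrow> real^'n" where
  "LQ_exp A B Q x \<tau> p = R3 A B Q \<tau> *v p + R4 A B Q \<tau> *v x"

text \<open>First conjugate time: first t > 0 at which the differential of
  p \<mapsto> exp_{x,t}(p), namely R_3(t), degenerates (+infinity if none).\<close>
definition first_conjugate_time :: "real^'n^'n \<Rightarrow> real^'m^'n \<Rightarrow> real^'n^'n \<Rightarrow> ereal" where
  "first_conjugate_time A B Q = Inf {ereal t | t. 0 < t \<and> det (R3 A B Q t) = 0}"

text \<open>Admissible pairs (control, trajectory) on [0,T] from x to y:
  u square integrable, gamma a (Caratheodory) solution of gamma' = A gamma + B u.\<close>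
definition admissible :: "real^'n^'n \<Rightarrow> real^'m^'n \<Rightarrow> real \<Rightarrow> real^'n \<Rightarrow> real^'n
    \<Rightarrow> ((real \<Rightarrow> real^'m) \<times> (real \<Rightarrow> real^'n)) set" where
  "admissible A B T x y = {(u, \<gamma>).
     set_borel_measurable lborel {0..T} u \<and>
     set_integrable lborel {0..T} (\<lambda>t. (norm (u t))\<^sup>2) \<and>
     set_integrable lborel {0..T} (\<lambda>t. A *v \<gamma> t + B *v u t) \<and>
     (\<forall>t\<in>{0..T}. \<gamma> t = x + (LINT s:{0..t}|lborel. A *v \<gamma> s + B *v u s)) \<and>
     \<gamma> 0 = x \<and> \<gamma> T = y}"

definition LQ_functional :: "real^'n^'n \<Rightarrow> real \<Rightarrow> (real \<Rightarrow> real^'m) \<Rightarrow> (real \<Rightarrow> real^'n) \<Rightarrow> real" where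
  "LQ_functional Q T u \<gamma> = (1/2) * (LINT t:{0..T}|lborel. (norm (u t))\<^sup>2 - \<gamma> t \<bullet> (Q *v \<gamma> t))"

text \<open>The LQ cost c^{0,T}(x,y) (finite under the standing assumptions).\<close>
definition LQ_cost :: "real^'n^'n \<Rightarrow> real^'m^'n \<Rightarrow> real^'n^'n \<Rightarrow> real \<Rightarrow> real^'n \<Rightarrow> real^'n \<Rightarrow> real" where
  "LQ_cost A B Q T x y =
     real_of_ereal (INF p\<in>admissible A B T x y. ereal (LQ_functional Q T (fst p) (snd p)))"

section \<open>Optimal transport notions\<close>

definition P2 :: "('a::euclidean_space) measure \<Rightarrow> bool" where
  "P2 \<mu> \<longleftrightarrow> sets \<mu> = sets borel \<and> prob_space \<mu> \<and> integrable \<mu> (\<lambda>x. (norm x)\<^sup>2)"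

definition couplings :: "('a::euclidean_space) measure \<Rightarrow> 'a measure \<Rightarrow> ('a \<times> 'a) measure set" where
  "couplings \<mu> \<nu> = {\<pi>. sets \<pi> = sets borel \<and> prob_space \<pi> \<and>
                      distr \<pi> borel fst = \<mu> \<and> distr \<pi> borel snd = \<nu>}"

definition optimal_plan :: "('a::euclidean_space \<Rightarrow> 'a \<Rightarrow> real) \<Rightarrow> 'a measure \<Rightarrow> 'a measure
    \<Rightarrow> ('a \<times> 'a) measure \<Rightarrow> bool" where
  "optimal_plan c \<mu> \<nu> \<pi> \<longleftrightarrow> \<pi> \<in> couplings \<mu> \<nu> \<and>
     (\<forall>\<pi>'\<in>couplings \<mu> \<nu>. (\<integral>z. c (fst z) (snd z) \<partial>\<pi>) \<le> (\<integral>z. c (fst z) (snd z) \<partial>\<pi>'))"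

text \<open>c-convexity (Villani, Def. 5.2): psi : R^n \<rightarrow> R \<union> {+\<infinity>}, not identically +\<infinity>,
  psi(x) = sup_y (zeta(y) - c(x,y)) for some zeta.\<close>
definition c_convex :: "('a \<Rightarrow> 'a \<Rightarrow> real) \<Rightarrow> ('a \<Rightarrow> ereal) \<Rightarrow> bool" where
  "c_convex c \<psi> \<longleftrightarrow> (\<exists>x. \<psi> x \<noteq> \<infinity>) \<and> (\<forall>x. \<psi> x \<noteq> -\<infinity>) \<and>
     (\<exists>\<zeta>. \<forall>x. \<psi> x = (SUP y. \<zeta> y - ereal (c x y)))"

definition c_transform :: "('a \<Rightarrow> 'a \<Rightarrow> real) \<Rightarrow> ('a \<Rightarrow> ereal) \<Rightarrow> 'a \<Rightarrow> ereal" where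
  "c_transform c \<psi> y = (INF x. \<psi> x + ereal (c x y))"

text \<open>Kantorovich potential: a c-convex psi whose c-subdifferential
  {(x,y). psi^c(y) - psi(x) = c(x,y)} carries an optimal plan.\<close>
definition kantorovich_potential :: "('a::euclidean_space \<Rightarrow> 'a \<Rightarrow> real) \<Rightarrow> 'a measure \<Rightarrow> 'a measure
    \<Rightarrow> ('a \<Rightarrow> ereal) \<Rightarrow> bool" where
  "kantorovich_potential c \<mu> \<nu> \<psi> \<longleftrightarrow> c_convex c \<psi> \<and>
     (\<exists>\<pi>. optimal_plan c \<mu> \<nu> \<pi> \<and>
        (AE z in \<pi>. \<psi> (fst z) \<noteq> \<infinity> \<and>
                     c_transform c \<psi> (snd z) = \<psi> (fst z) + ereal (c (fst z) (snd z))))"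

section \<open>Differential notions\<close>

definition grad :: "(real^'n \<Rightarrow> real) \<Rightarrow> real^'n \<Rightarrow> real^'n" where
  "grad f x = (\<chi> i. frechet_derivative f (at x) (axis i 1))"

text \<open>psi is (classically) twice differentiable at x: finite and differentiable
  on a neighbourhood of x, with gradient differentiable at x.\<close>
definition twice_differentiable_at :: "(real^'n \<Rightarrow> ereal) \<Rightarrow> real^'n \<Rightarrow> bool" where
  "twice_differentiable_at \<psi> x \<longleftrightarrow>
     (\<exists>U. open U \<and> x \<in> U \<and>
        (\<forall>y\<in>U. \<bar>\<psi> y\<bar> \<noteq> \<infinity> \<and> (\<lambda>z. real_of_ereal (\<psi> z)) differentiable (at y))) \<and>
     grad (\<lambda>z. real_of_ereal (\<psi> z)) differentiable (at x)"

text \<open>T_tau(x) = exp_{x,tau}(grad psi(x)).\<close>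
definition transport_map :: "real^'n^'n \<Rightarrow> real^'m^'n \<Rightarrow> real^'n^'n \<Rightarrow> (real^'n \<Rightarrow> ereal)
    \<Rightarrow> real \<Rightarrow> real^'n \<Rightarrow> real^'n" where
  "transport_map A B Q \<psi> \<tau> x = LQ_exp A B Q x \<tau> (grad (\<lambda>z. real_of_ereal (\<psi> z)) x)"

end

theory Submission
  imports Defs
begin

text \<open>
  Let \<open>S(t) = R\<^sub>3(t)\<^sup>-\<^sup>1 R\<^sub>4(t)\<close> and let \<open>G\<close> be the Hessian of \<open>\<psi>\<close> at \<open>x\<close>. Invariance of the symplectic
  form under the Hamiltonian flow makes \<open>S(t)\<close> symmetric and nonincreasing before the first conjugate
  time. The Jacobian of \<open>T\<^sub>\<tau>\<close> at \<open>x\<close> is \<open>R\<^sub>3(\<tau>) G + R\<^sub>4(\<tau>) = R\<^sub>3(\<tau>) ((G + S(s)) + (S(\<tau>) - S(s)))\<close>, and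
  \<open>R\<^sub>3(\<tau>) (S(\<tau>) - S(s)) = R\<^sub>3(\<tau> - s) R\<^sub>3(-s)\<^sup>-\<^sup>1\<close>, so the claim is Minkowski's determinant inequality once
  \<open>G + S(T)\<close> is known to be positive semidefinite.

  For the latter, perturbing a nearly optimal trajectory from \<open>x\<close> to \<open>y\<close> by plus and minus the extremal
  from \<open>h\<close> to \<open>0\<close> gives \<open>c(x + h, y) + c(x - h, y) - 2 c(x, y) \<le> h \<bullet> S(T) h\<close>, which passes to
  \<open>\<psi>\<close> through the supremum defining \<open>c\<close>-convexity. This needs \<open>c\<close> to be finite, which follows by completing
  the square with a Riccati solution built from the extremals with \<open>x(0) = \<delta> p(0)\<close>, \<open>\<delta> > 0\<close> small: the
  matrix \<open>R\<^sub>3 + \<delta> R\<^sub>4\<close> is regular on all of \<open>[0,T]\<close>, and comparing its determinant with that at time \<open>0\<close>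
  also yields \<open>det R\<^sub>3 > 0\<close> on \<open>(0,T]\<close>.
\<close>

section \<open>Linear algebra\<close>

lemma inner_matrix_vector_mult:
  fixes A :: "real^'n^'m"
  shows "(A *v x) \<bullet> y = x \<bullet> (transpose A *v y)"
  by (metis dot_lmul_matrix inner_commute transpose_matrix_vector)

lemma matrix_add_rdistrib: "(A + B) ** C = A ** C + B ** C"
  by (vector matrix_matrix_mult_def sum.distrib[symmetric] field_simps)

lemma inner_matrix_vector_mult_symmetric:
  fixes A :: "real^'n^'n"
  assumes "transpose A = A"
  shows "x \<bullet> (A *v y) = y \<bullet> (A *v x)"
  by (metis assms inner_commute inner_matrix_vector_mult)

lemma symmetric_matrixI:
  fixes A :: "real^'n^'n"
  assumes "\<And>x y. x \<bullet> (A *v y) = y \<bullet> (A *v x)"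
  shows "transpose A = A"
proof -
  have "(transpose A *v y) \<bullet> x = (A *v y) \<bullet> x" for x y
    by (metis assms inner_commute inner_matrix_vector_mult)
  then show ?thesis
    by (metis matrix_eq vector_eq_rdot)
qed

text \<open>The columns of \<open>C\<close> are the vectors \<open>b j\<close>, so the congruence is
  a Gram matrix. This turns pairings of vectors into matrix identities.\<close>

lemma congruence_entry:
  fixes M :: "real^'n^'n" and b :: "'n \<Rightarrow> real^'n"
  defines "C \<equiv> \<chi> i j. b j $ i"
  shows "(transpose C ** M ** C) $ i $ j = b i \<bullet> (M *v b j)"
proof -
  have "(transpose C ** M ** C) $ i $ j = (\<Sum>k\<in>UNIV. (\<Sum>m\<in>UNIV. b i $ m * M $ m $ k) * b j $ k)"
    by (simp add: C_def matrix_matrix_mult_def transpose_def)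
  also have "\<dots> = (\<Sum>m\<in>UNIV. \<Sum>k\<in>UNIV. b i $ m * M $ m $ k * b j $ k)"
    by (subst sum.swap) (simp add: sum_distrib_right)
  also have "\<dots> = b i \<bullet> (M *v b j)"
    by (simp add: inner_vec_def matrix_vector_mult_def sum_distrib_left mult.assoc)
  finally show ?thesis .
qed

section \<open>Simultaneous diagonalization of two quadratic forms\<close>

text \<open>A parabola that vanishes at \<open>0\<close> and stays nonpositive has slope zero there.
  This is the first-order condition at an extremum of a quadratic form.\<close>

lemma linear_term_zero_if_quadratic_nonpos:
  fixes a c :: real
  assumes "\<And>t. 2 * t * a + t\<^sup>2 * c \<le> 0"
  shows "a = 0"
proof (rule ccontr)
  assume "a \<noteq> 0"
  \<comment> \<open>For this \<open>t\<close> the linear term is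
    \<open>2 * t\<^sup>2 * (\<bar>c\<bar> + 1)\<close>, which outweighs the quadratic one.\<close>
  define t where "t = a / (\<bar>c\<bar> + 1)"
  have "t * (\<bar>c\<bar> + 1) = a" by (simp add: t_def)
  moreover have "t * a > 0"
    using \<open>a \<noteq> 0\<close> by (auto simp: t_def zero_less_divide_iff zero_less_mult_iff)
  moreover have "t\<^sup>2 * c \<ge> - (t\<^sup>2 * (\<bar>c\<bar> + 1))"
    by (smt (verit) mult_left_mono mult_minus_right zero_le_power2)
  ultimately show False
    using assms[of t] by (simp add: power2_eq_square mult.assoc)
qed

text \<open>The quotient is invariant under scaling, so its maximum on the compact unit sphere of
  \<open>W\<close> is a maximum on all of \<open>W\<close>; the maximizer is then rescaled to unit
  length for \<open>M\<close>.\<close>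

lemma rayleigh_maximizer:
  fixes M N :: "real^'n^'n" and W :: "(real^'n) set"
  assumes pd: "\<And>v. v \<noteq> 0 \<Longrightarrow> 0 < v \<bullet> (M *v v)" and W: "subspace W" "w \<in> W" "w \<noteq> 0"
  obtains v \<rho> where "v \<in> W" "v \<bullet> (M *v v) = 1" "v \<bullet> (N *v v) = \<rho>"
    "\<And>w. w \<in> W \<Longrightarrow> w \<bullet> (N *v w) \<le> \<rho> * (w \<bullet> (M *v w))"
proof -
  define q where "q v = (v \<bullet> (N *v v)) / (v \<bullet> (M *v v))" for v
  have scale: "q (c *\<^sub>R v) = q v" if "c \<noteq> 0" for c v
    using that by (simp add: q_def matrix_vector_mult_scaleR)
  have sph: "w /\<^sub>R norm w \<in> W \<inter> sphere 0 1" if "w \<in> W" "w \<noteq> 0" for w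
    using that W by (simp add: subspace_scale)
  have nz: "v \<bullet> (M *v v) \<noteq> 0" if "v \<in> W \<inter> sphere 0 1" for v
    using that pd[of v] by (cases "v = 0") auto
  have "compact (W \<inter> sphere 0 1)"
    using W(1) by (simp add: closed_Int_compact closed_subspace)
  moreover have "W \<inter> sphere 0 1 \<noteq> {}"
    using sph W by blast
  moreover have "continuous_on (W \<inter> sphere 0 1) q"
    unfolding q_def using nz by (intro continuous_intros ballI)
  ultimately obtain v where v: "v \<in> W \<inter> sphere 0 1" and max: "\<And>w. w \<in> W \<inter> sphere 0 1 \<Longrightarrow> q w \<le> q v"
    using continuous_attains_sup by metis
  have v0: "v \<noteq> 0" using v by auto
  define c where "c = 1 / sqrt (v \<bullet> (M *v v))"
  have c: "c \<noteq> 0" "c * c * (v \<bullet> (M *v v)) = 1"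
    using pd[OF v0] by (auto simp: c_def real_sqrt_mult_self)
  show thesis
  proof
    show "c *\<^sub>R v \<in> W" using v W by (simp add: subspace_scale)
    show 1: "c *\<^sub>R v \<bullet> (M *v (c *\<^sub>R v)) = 1"
      using c by (simp add: matrix_vector_mult_scaleR)
    have "q v = q (c *\<^sub>R v)" using scale c by simp
    then show "c *\<^sub>R v \<bullet> (N *v (c *\<^sub>R v)) = q v"
      by (simp only: q_def 1 div_by_1)
    fix w assume "w \<in> W"
    show "w \<bullet> (N *v w) \<le> q v * (w \<bullet> (M *v w))"
    proof (cases "w = 0")
      case False
      then have "q (w /\<^sub>R norm w) \<le> q v"
        using max sph \<open>w \<in> W\<close> by blast
      moreover have "q (w /\<^sub>R norm w) = q w"
        using False by (intro scale) simp
      ultimately have "q w \<le> q v" by simp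
      then show ?thesis
        using pd[OF False] by (simp add: q_def pos_divide_le_eq)
    qed simp
  qed
qed

text \<open>Generalized eigenvectors of the pencil \<open>N - \<rho> M\<close> are added one at a time, as maximizers of the
  Rayleigh quotient on the \<open>M\<close>-orthogonal complement of those already found.\<close>
lemma generalized_eigenvectors:
  fixes M N :: "real^'n^'n" and I :: "'n set"
  assumes sym: "transpose M = M" "transpose N = N"
    and pd: "\<And>v. v \<noteq> 0 \<Longrightarrow> 0 < v \<bullet> (M *v v)"
  shows "\<exists>b l. (\<forall>i\<in>I. \<forall>j\<in>I. b i \<bullet> (M *v b j) = (if i = j then 1 else 0)) \<and>
               (\<forall>i\<in>I. N *v b i = l i *\<^sub>R (M *v b i))"
  using finite[of I]
proof (induction I rule: finite_induct)
  case (insert k I)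
  then obtain b l where b: "\<And>i j. i \<in> I \<Longrightarrow> j \<in> I \<Longrightarrow> b i \<bullet> (M *v b j) = (if i = j then 1 else 0)"
    and l: "\<And>i. i \<in> I \<Longrightarrow> N *v b i = l i *\<^sub>R (M *v b i)"
    by blast
  define W where "W = {v. \<forall>i\<in>I. v \<bullet> (M *v b i) = 0}"
  have W: "subspace W"
    by (auto simp: W_def subspace_def inner_add_left)
  \<comment> \<open>Fewer than \<open>CARD('n)\<close> orthogonality constraints leave a nonzero
    vector in \<open>W\<close>.\<close>
  have "dim ((\<lambda>i. M *v b i) ` I) \<le> card I"
    using dim_le_card[of "(\<lambda>i. M *v b i) ` I" "(\<lambda>i. M *v b i) ` I"] card_image_le[of I]
    by (meson finite finite_imageI order_trans span_superset)
  also have "card I < CARD('n)"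
    using insert.hyps by (metis finite psubset_card_mono psubsetI subset_UNIV UNIV_I)
  finally have "dim ((\<lambda>i. M *v b i) ` I) < DIM(real^'n)" by simp
  then obtain w where "w \<noteq> 0" "\<And>y. y \<in> span ((\<lambda>i. M *v b i) ` I) \<Longrightarrow> orthogonal w y"
    using orthogonal_to_subspace_exists by blast
  then have "w \<in> W" "w \<noteq> 0"
    by (auto simp: W_def orthogonal_def span_base)
  then obtain v \<rho> where v: "v \<in> W" "v \<bullet> (M *v v) = 1" "v \<bullet> (N *v v) = \<rho>"
    and max: "\<And>w. w \<in> W \<Longrightarrow> w \<bullet> (N *v w) \<le> \<rho> * (w \<bullet> (M *v w))"
    using rayleigh_maximizer[OF pd W] by metis
  define F where "F = N - \<rho> *\<^sub>R M"
  have F: "F *v u = N *v u - \<rho> *\<^sub>R (M *v u)" for u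
    by (simp add: F_def matrix_vector_mult_diff_rdistrib scaleR_matrix_vector_assoc)
  have Fsym: "x \<bullet> (F *v y) = y \<bullet> (F *v x)" for x y
    using sym inner_matrix_vector_mult_symmetric[of N x y] inner_matrix_vector_mult_symmetric[of M x y]
    by (simp add: F inner_diff_right)
  \<comment> \<open>On \<open>W\<close> the form of \<open>F\<close> is nonpositive and it vanishes
    at \<open>v\<close>, so its first variation at \<open>v\<close> along \<open>W\<close> is
    zero.\<close>
  have W_zero: "w \<bullet> (F *v v) = 0" if "w \<in> W" for w
  proof (rule linear_term_zero_if_quadratic_nonpos)
    fix t
    have "v + t *\<^sub>R w \<in> W" using W v that by (simp add: subspace_add subspace_scale)
    then have "(v + t *\<^sub>R w) \<bullet> (F *v (v + t *\<^sub>R w)) \<le> 0"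
      using max by (simp add: F inner_diff_right)
    moreover have "v \<bullet> (F *v v) = 0" using v by (simp add: F inner_diff_right)
    ultimately show "2 * t * (w \<bullet> (F *v v)) + t\<^sup>2 * (w \<bullet> (F *v w)) \<le> 0"
      using Fsym[of v w]
      by (simp add: matrix_vector_right_distrib matrix_vector_mult_scaleR inner_add_left
          inner_add_right power2_eq_square algebra_simps)
  qed
  have b_zero: "b i \<bullet> (F *v v) = 0" if "i \<in> I" for i
    using that v(1) Fsym[of "b i" v] l[OF that] by (auto simp: F W_def inner_diff_right)
  have "u \<bullet> (F *v v) = 0" for u
  proof -
    \<comment> \<open>The \<open>M\<close>-orthogonal projection of \<open>u\<close> onto the
      vectors already found. Both \<open>p\<close> and \<open>u - p\<close> are orthogonal to
      \<open>F *v v\<close>, so the eigenvector equation holds on the whole space and not only when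
      tested on \<open>W\<close>.\<close>
    define p where "p = (\<Sum>i\<in>I. (u \<bullet> (M *v b i)) *\<^sub>R b i)"
    have "p \<bullet> (M *v b j) = u \<bullet> (M *v b j)" if "j \<in> I" for j
    proof -
      have "p \<bullet> (M *v b j) = (\<Sum>i\<in>I. if i = j then u \<bullet> (M *v b i) else 0)"
        unfolding p_def inner_sum_left using b that by (intro sum.cong) auto
      then show ?thesis using that by simp
    qed
    then have "u - p \<in> W" by (auto simp: W_def inner_diff_left)
    moreover have "p \<bullet> (F *v v) = 0"
      unfolding p_def inner_sum_left using b_zero by simp
    ultimately show ?thesis using W_zero[of "u - p"] by (simp add: inner_diff_left)
  qed
  then have "F *v v = 0" by (metis inner_eq_zero_iff)
  then have Nv: "N *v v = \<rho> *\<^sub>R (M *v v)" by (simp add: F)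
  have vb: "v \<bullet> (M *v b i) = 0" "b i \<bullet> (M *v v) = 0" if "i \<in> I" for i
    using v(1) that inner_matrix_vector_mult_symmetric[OF sym(1), of v "b i"] by (auto simp: W_def)
  show ?case
    using insert.hyps b l vb Nv v(2)
    by (intro exI[of _ "b(k := v)"] exI[of _ "l(k := \<rho>)"]) auto
qed auto

text \<open>The last conclusion presents the diagonal entries as values of the form of
  \<open>N\<close>, so semidefiniteness of \<open>N\<close> passes to the signs of the
  \<open>l i\<close>.\<close>

lemma simultaneous_diagonalization:
  fixes M N :: "real^'n^'n"
  assumes sym: "transpose M = M" "transpose N = N"
    and pd: "\<And>v. v \<noteq> 0 \<Longrightarrow> 0 < v \<bullet> (M *v v)"
  obtains C :: "real^'n^'n" and l where "transpose C ** M ** C = mat 1"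
    "transpose C ** N ** C = (\<chi> i j. if i = j then l i else 0)"
    "\<forall>i. \<exists>v. l i = v \<bullet> (N *v v)"
proof -
  have "\<exists>b l. (\<forall>i\<in>(UNIV::'n set). \<forall>j\<in>UNIV. b i \<bullet> (M *v b j) = (if i = j then 1 else 0)) \<and>
      (\<forall>i\<in>UNIV. N *v b i = l i *\<^sub>R (M *v b i))"
    by (rule generalized_eigenvectors[OF sym pd])
  then obtain b l where b: "\<And>i j :: 'n. b i \<bullet> (M *v b j) = (if i = j then 1 else 0)"
    and l: "\<And>i. N *v b i = l i *\<^sub>R (M *v b i)"
    by blast
  have N: "b i \<bullet> (N *v b j) = (if i = j then l i else 0)" for i j
    by (simp add: l b)
  show thesis
  proof
    show "transpose (\<chi> i j. b j $ i) ** M ** (\<chi> i j. b j $ i) = mat 1"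
      by (simp add: vec_eq_iff congruence_entry b mat_def)
    show "transpose (\<chi> i j. b j $ i) ** N ** (\<chi> i j. b j $ i) = (\<chi> i j. if i = j then l i else 0)"
      by (simp add: vec_eq_iff congruence_entry N)
    show "\<forall>i. \<exists>v. l i = v \<bullet> (N *v v)"
      using N by (metis (full_types))
  qed
qed

section \<open>Minkowski's determinant inequality\<close>

text \<open>The arithmetic-geometric mean inequality. A vanishing product is treated apart because
  rewriting \<open>root\<close> as a real power uses a positive argument.\<close>

lemma root_prod_le_mean:
  fixes a :: "'n::finite \<Rightarrow> real"
  assumes "\<And>i. 0 \<le> a i"
  shows "root CARD('n) (\<Prod>i\<in>UNIV. a i) \<le> (\<Sum>i\<in>UNIV. a i / CARD('n))"
proof (cases "(\<Prod>i\<in>UNIV. a i) = 0")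
  case True
  have "0 \<le> (\<Sum>i\<in>UNIV. a i / CARD('n))" using assms by (simp add: sum_nonneg)
  then show ?thesis unfolding True by simp
next
  case False
  then have "0 < (\<Prod>i\<in>UNIV. a i)"
    using assms by (simp add: less_le prod_nonneg)
  then show ?thesis
    using arith_geom_mean[of UNIV a] assms by (simp add: root_powr_inverse)
qed

text \<open>After division by the right-hand side, the two summands are geometric means of
  \<open>1 / (1 + l i)\<close> and of \<open>l i / (1 + l i)\<close>, and the corresponding
  arithmetic means add up to one.\<close>

lemma root_prod_superadditive:
  fixes l :: "'n::finite \<Rightarrow> real"
  assumes l: "\<And>i. 0 \<le> l i"
  shows "1 + root CARD('n) (\<Prod>i\<in>UNIV. l i) \<le> root CARD('n) (\<Prod>i\<in>UNIV. 1 + l i)"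
proof -
  define r where "r = root CARD('n) (\<Prod>i\<in>UNIV. 1 + l i)"
  have pos: "0 < 1 + l i" for i using l[of i] by simp
  have r: "r > 0" unfolding r_def using pos by (simp add: prod_pos)
  have "1 / r = root CARD('n) (\<Prod>i\<in>UNIV. 1 / (1 + l i))"
    by (simp add: r_def prod_dividef real_root_divide)
  also have "\<dots> \<le> (\<Sum>i\<in>UNIV. 1 / (1 + l i) / CARD('n))"
    using pos by (intro root_prod_le_mean) (simp add: less_imp_le)
  finally have 1: "1 / r \<le> (\<Sum>i\<in>UNIV. 1 / (1 + l i) / CARD('n))" .
  have "root CARD('n) (\<Prod>i\<in>UNIV. l i) / r = root CARD('n) (\<Prod>i\<in>UNIV. l i / (1 + l i))"
    by (simp add: r_def prod_dividef real_root_divide)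
  also have "\<dots> \<le> (\<Sum>i\<in>UNIV. l i / (1 + l i) / CARD('n))"
    using pos l by (intro root_prod_le_mean) (simp add: less_imp_le)
  finally have "(1 + root CARD('n) (\<Prod>i\<in>UNIV. l i)) / r
      \<le> (\<Sum>i\<in>UNIV. 1 / (1 + l i) / CARD('n) + l i / (1 + l i) / CARD('n))"
    using 1 by (simp add: add_divide_distrib sum.distrib)
  also have "\<dots> = (\<Sum>i\<in>(UNIV::'n set). 1 / CARD('n))"
  proof (rule sum.cong)
    fix i
    show "1 / (1 + l i) / CARD('n) + l i / (1 + l i) / CARD('n) = 1 / CARD('n)"
      using pos[of i] by (simp add: add_divide_distrib [symmetric])
  qed simp
  also have "\<dots> = 1" by simp
  finally show ?thesis using r by (simp add: r_def)
qed

text \<open>Congruence by \<open>C\<close> multiplies every determinant by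
  \<open>(det C)\<^sup>2\<close>, which reduces all three claims to diagonal matrices.\<close>

lemma det_pos_semidefinite:
  fixes M N :: "real^'n^'n"
  assumes sym: "transpose M = M" "transpose N = N"
    and pd: "\<And>v. v \<noteq> 0 \<Longrightarrow> 0 < v \<bullet> (M *v v)" and psd: "\<And>v. 0 \<le> v \<bullet> (N *v v)"
  shows det_positive_definite: "0 < det M"
    and det_nonneg_semidefinite: "0 \<le> det N"
    and minkowski_determinant:
      "root CARD('n) (det M) + root CARD('n) (det N) \<le> root CARD('n) (det (M + N))"
proof -
  obtain C :: "real^'n^'n" and l where C: "transpose C ** M ** C = mat 1"
    "transpose C ** N ** C = (\<chi> i j. if i = j then l i else 0)"
    and l_form: "\<forall>i. \<exists>v. l i = v \<bullet> (N *v v)"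
    using simultaneous_diagonalization[OF sym] pd by blast
  have l: "0 \<le> l i" for i using psd l_form by metis
  define c where "c = (det C)\<^sup>2"
  have det_eq: "c * det X = det (transpose C ** X ** C)" for X
    by (simp add: c_def det_mul power2_eq_square)
  have M: "c * det M = 1" by (simp add: det_eq C)
  then have c: "c > 0" unfolding c_def by (metis mult_zero_left power2_eq_square zero_less_power2 zero_neq_one)
  have N: "c * det N = (\<Prod>i\<in>UNIV. l i)"
    by (simp add: det_eq C det_diagonal)
  have "transpose C ** (M + N) ** C = (\<chi> i j. if i = j then 1 + l i else 0)"
    by (simp add: matrix_add_ldistrib matrix_add_rdistrib C) (simp add: vec_eq_iff mat_def)
  then have MN: "c * det (M + N) = (\<Prod>i\<in>UNIV. 1 + l i)"
    by (simp add: det_eq det_diagonal)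
  show "0 < det M" using M c by (metis zero_less_mult_pos zero_less_one)
  have "0 \<le> c * det N" unfolding N using l by (simp add: prod_nonneg)
  then show "0 \<le> det N" using c by (simp add: zero_le_mult_iff)
  have "root CARD('n) (c * det M) + root CARD('n) (c * det N) \<le> root CARD('n) (c * det (M + N))"
    unfolding M N MN using root_prod_superadditive[of l] l by simp
  then have "root CARD('n) c * (root CARD('n) (det M) + root CARD('n) (det N))
      \<le> root CARD('n) c * root CARD('n) (det (M + N))"
    by (simp add: real_root_mult distrib_left)
  then show "root CARD('n) (det M) + root CARD('n) (det N) \<le> root CARD('n) (det (M + N))"
    using c by simp
qed

section \<open>Matrix-valued functions\<close>

lemma bounded_bilinear_matrix_vector_mult:
  "bounded_bilinear ((*v) :: real^'n^'m \<Rightarrow> real^'n \<Rightarrow> real^'m)"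
  unfolding bilinear_conv_bounded_bilinear [symmetric] bilinear_def
  by (auto intro!: linearI simp: matrix_vector_right_distrib matrix_vector_mult_add_rdistrib
      matrix_vector_mult_scaleR scaleR_matrix_vector_assoc)

lemma bounded_bilinear_matrix_matrix_mult:
  "bounded_bilinear ((**) :: real^'n^'m \<Rightarrow> real^'p^'n \<Rightarrow> real^'p^'m)"
  unfolding bilinear_conv_bounded_bilinear [symmetric] bilinear_def
  by (auto intro!: linearI simp: matrix_add_ldistrib matrix_add_rdistrib)
    (simp_all add: vec_eq_iff matrix_matrix_mult_def sum_distrib_left mult.assoc mult.left_commute)

lemma has_vector_derivative_vec:
  fixes f :: "real \<Rightarrow> 'b::euclidean_space^'n"
  assumes "\<And>i. ((\<lambda>t. f t $ i) has_vector_derivative f' $ i) (at x within S)"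
  shows "(f has_vector_derivative f') (at x within S)"
  unfolding has_vector_derivative_def
proof (subst has_derivative_componentwise_within, intro ballI)
  fix b :: "'b^'n" assume "b \<in> Basis"
  then obtain i u where b: "b = axis i u" by (auto simp: Basis_vec_def)
  have "((\<lambda>t. f t $ i \<bullet> u) has_derivative (\<lambda>y. (y *\<^sub>R f' $ i) \<bullet> u)) (at x within S)"
    using assms[of i] unfolding has_vector_derivative_def by (rule has_derivative_inner_left)
  then show "((\<lambda>t. f t \<bullet> b) has_derivative (\<lambda>y. y *\<^sub>R f' \<bullet> b)) (at x within S)"
    by (simp add: b inner_axis)
qed

lemma has_vector_derivative_vec_nth:
  fixes f :: "real \<Rightarrow> 'b::real_normed_vector^'n"
  assumes "(f has_vector_derivative f') (at x within S)"
  shows "((\<lambda>t. f t $ i) has_vector_derivative f' $ i) (at x within S)"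
  by (rule bounded_linear.has_vector_derivative[OF bounded_linear_vec_nth assms])

lemma has_vector_derivative_matrix:
  fixes X :: "real \<Rightarrow> real^'n^'m"
  assumes "\<And>v. ((\<lambda>t. X t *v v) has_vector_derivative X' *v v) (at x within S)"
  shows "(X has_vector_derivative X') (at x within S)"
proof (intro has_vector_derivative_vec)
  fix i j
  show "((\<lambda>t. X t $ i $ j) has_vector_derivative X' $ i $ j) (at x within S)"
    using has_vector_derivative_vec_nth[OF assms[of "axis j 1"], of i]
    by (simp add: matrix_vector_mult_basis column_def)
qed

text \<open>In this form the derivative of a matrix inverse becomes a limit of products.\<close>

lemma has_vector_derivative_iff_quotient:
  "(f has_vector_derivative f') (at x within S) \<longleftrightarrow>
   ((\<lambda>y. (1 / (y - x)) *\<^sub>R (f y - f x)) \<longlongrightarrow> f') (at x within S)"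
proof -
  have "(f has_vector_derivative f') (at x within S) \<longleftrightarrow>
    ((\<lambda>y. (1 / norm (y - x)) *\<^sub>R (f y - (f x + (y - x) *\<^sub>R f'))) \<longlongrightarrow> 0) (at x within S)"
    by (simp add: has_vector_derivative_def has_derivative_within bounded_linear_scaleR_left)
  also have "\<dots> \<longleftrightarrow> ((\<lambda>y. norm ((1 / norm (y - x)) *\<^sub>R (f y - (f x + (y - x) *\<^sub>R f')))) \<longlongrightarrow> 0) (at x within S)"
    by (simp only: tendsto_norm_zero_iff)
  also have "\<dots> \<longleftrightarrow> ((\<lambda>y. norm ((1 / (y - x)) *\<^sub>R (f y - f x) - f')) \<longlongrightarrow> 0) (at x within S)"
  proof (rule filterlim_cong[OF refl refl], unfold eventually_at_filter, rule always_eventually, intro allI impI)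
    fix y assume "y \<noteq> x"
    then have "(1 / (y - x)) *\<^sub>R (f y - f x) - f' = (1 / (y - x)) *\<^sub>R (f y - (f x + (y - x) *\<^sub>R f'))"
      by (simp add: scaleR_diff_right scaleR_add_right)
    then show "norm ((1 / norm (y - x)) *\<^sub>R (f y - (f x + (y - x) *\<^sub>R f'))) =
        norm ((1 / (y - x)) *\<^sub>R (f y - f x) - f')"
      by simp
  qed
  also have "\<dots> \<longleftrightarrow> ((\<lambda>y. (1 / (y - x)) *\<^sub>R (f y - f x)) \<longlongrightarrow> f') (at x within S)"
    by (simp only: tendsto_norm_zero_iff flip: LIM_zero_iff[of _ f'])
  finally show ?thesis .
qed

section \<open>Continuity and derivative of the matrix inverse\<close>

lemma matrix_inv_mult:
  fixes X :: "real^'n^'n"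
  assumes "det X \<noteq> 0"
  shows matrix_inv_left_mult: "matrix_inv X ** X = mat 1"
    and matrix_inv_right_mult: "X ** matrix_inv X = mat 1"
proof -
  have "\<exists>Y. X ** Y = mat 1 \<and> Y ** X = mat 1"
    using assms invertible_det_nz[of X] by (simp add: invertible_def)
  then have "X ** matrix_inv X = mat 1 \<and> matrix_inv X ** X = mat 1"
    unfolding matrix_inv_def by (rule someI_ex)
  then show "matrix_inv X ** X = mat 1" "X ** matrix_inv X = mat 1" by auto
qed

lemma matrix_inv_vector:
  fixes X :: "real^'n^'n"
  assumes "det X \<noteq> 0"
  shows matrix_inv_vector_left: "matrix_inv X *v (X *v v) = v"
    and matrix_inv_vector_right: "X *v (matrix_inv X *v v) = v"
  by (simp_all add: matrix_vector_mul_assoc matrix_inv_mult[OF assms])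

lemma tendsto_det:
  fixes X :: "'a \<Rightarrow> real^'n^'n"
  assumes "(X \<longlongrightarrow> X0) F"
  shows "((\<lambda>t. det (X t)) \<longlongrightarrow> det X0) F"
  unfolding det_def by (intro tendsto_intros assms)

text \<open>Cramer's rule writes each entry of the inverse as a quotient of determinants, and the
  denominator is eventually nonzero because its limit is.\<close>

lemma tendsto_matrix_inv:
  fixes X :: "'a \<Rightarrow> real^'n^'n"
  assumes X: "(X \<longlongrightarrow> X0) F" and det: "det X0 \<noteq> 0"
  shows "((\<lambda>t. matrix_inv (X t)) \<longlongrightarrow> matrix_inv X0) F"
proof (intro vec_tendstoI)
  fix i j
  define D where "D Y = det (\<chi> a c. if c = i then axis j 1 $ a else Y $ a $ c) / det Y" for Y :: "real^'n^'n"
  have D: "matrix_inv Y $ i $ j = D Y" if "det Y \<noteq> 0" for Y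
  proof -
    have "matrix_inv Y *v axis j 1 = (\<chi> k. det (\<chi> a c. if c = k then axis j 1 $ a else Y $ a $ c) / det Y)"
      using matrix_inv_vector_right[OF that, of "axis j 1"] cramer[OF that] by blast
    moreover have "matrix_inv Y $ i $ j = (matrix_inv Y *v axis j 1) $ i"
      by (simp add: matrix_vector_mult_basis column_def)
    ultimately show ?thesis by (simp add: D_def)
  qed
  have "((\<lambda>t. (\<chi> a c. if c = i then axis j 1 $ a else X t $ a $ c) :: real^'n^'n) \<longlongrightarrow>
      (\<chi> a c. if c = i then axis j 1 $ a else X0 $ a $ c)) F"
  proof (intro vec_tendstoI)
    fix a c
    show "((\<lambda>t. (\<chi> a c. if c = i then axis j 1 $ a else X t $ a $ c) $ a $ c) \<longlongrightarrow>
        (\<chi> a c. if c = i then axis j 1 $ a else X0 $ a $ c) $ a $ c) F"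
      using X by (cases "c = i") (auto intro!: tendsto_intros)
  qed
  then have "((\<lambda>t. D (X t)) \<longlongrightarrow> D X0) F"
    unfolding D_def by (intro tendsto_divide tendsto_det X det)
  moreover have "eventually (\<lambda>t. D (X t) = matrix_inv (X t) $ i $ j) F"
    using tendsto_imp_eventually_ne[OF tendsto_det[OF X] det] by eventually_elim (simp add: D)
  ultimately show "((\<lambda>t. matrix_inv (X t) $ i $ j) \<longlongrightarrow> matrix_inv X0 $ i $ j) F"
    unfolding D[OF det] by (rule Lim_transform_eventually)
qed

text \<open>The difference of two inverses is minus the difference of the matrices multiplied by one
  inverse on each side. The difference quotient of the inverse is thus that of \<open>X\<close>
  between factors that converge.\<close>

lemma has_vector_derivative_matrix_inv:
  fixes X :: "real \<Rightarrow> real^'n^'n"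
  assumes X: "(X has_vector_derivative X') (at x within S)" and det: "det (X x) \<noteq> 0"
  shows "((\<lambda>t. matrix_inv (X t)) has_vector_derivative - (matrix_inv (X x) ** X' ** matrix_inv (X x)))
    (at x within S)"
  unfolding has_vector_derivative_iff_quotient
proof -
  interpret mm: bounded_bilinear "(**) :: real^'n^'n \<Rightarrow> real^'n^'n \<Rightarrow> real^'n^'n"
    by (rule bounded_bilinear_matrix_matrix_mult)
  let ?q = "\<lambda>y. (1 / (y - x)) *\<^sub>R (X y - X x)"
  have lim: "(X \<longlongrightarrow> X x) (at x within S)"
    using has_vector_derivative_continuous[OF X] by (simp add: continuous_within)
  have "((\<lambda>y. - (matrix_inv (X y) ** ?q y ** matrix_inv (X x)))
      \<longlongrightarrow> - (matrix_inv (X x) ** X' ** matrix_inv (X x))) (at x within S)"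
    using X unfolding has_vector_derivative_iff_quotient
    by (intro tendsto_minus mm.tendsto tendsto_matrix_inv[OF lim det] tendsto_const)
  moreover have "eventually (\<lambda>y. - (matrix_inv (X y) ** ?q y ** matrix_inv (X x))
      = (1 / (y - x)) *\<^sub>R (matrix_inv (X y) - matrix_inv (X x))) (at x within S)"
    using tendsto_imp_eventually_ne[OF tendsto_det[OF lim] det]
  proof eventually_elim
    case (elim y)
    have "- (matrix_inv (X y) ** (X y - X x) ** matrix_inv (X x)) = matrix_inv (X y) - matrix_inv (X x)"
      using matrix_inv_mult[OF elim] matrix_inv_mult[OF det]
      by (simp add: mm.diff_left mm.diff_right matrix_mul_assoc[symmetric])
    then show ?case
      by (simp add: mm.scaleR_left mm.scaleR_right flip: scaleR_minus_right)
  qed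
  ultimately show "((\<lambda>y. (1 / (y - x)) *\<^sub>R (matrix_inv (X y) - matrix_inv (X x)))
      \<longlongrightarrow> - (matrix_inv (X x) ** X' ** matrix_inv (X x))) (at x within S)"
    by (rule Lim_transform_eventually)
qed

section \<open>Linear flows\<close>

text \<open>The exponential of \<open>t\<close> times \<open>L\<close>. Time sits inside the
  iterated map as in \<open>ham_exp\<close>, so that the two series agree as soon as the iterated
  maps do.\<close>

definition linear_flow :: "('a::euclidean_space \<Rightarrow> 'a) \<Rightarrow> real \<Rightarrow> 'a \<Rightarrow> 'a" where
  "linear_flow L t z = (\<Sum>k. (1 / fact k) *\<^sub>R (((\<lambda>w. t *\<^sub>R L w) ^^ k) z))"

context
  fixes L :: "'a::euclidean_space \<Rightarrow> 'a"
  assumes L: "linear L"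
begin

lemma linear_flow_eq: "linear_flow L t z = (\<Sum>k. (t ^ k / fact k) *\<^sub>R (L ^^ k) z)"
proof -
  have "((\<lambda>w. t *\<^sub>R L w) ^^ k) z = t ^ k *\<^sub>R (L ^^ k) z" for k
    by (induction k) (simp_all add: linear_scale[OF L])
  then show ?thesis by (simp add: linear_flow_def divide_inverse mult.commute)
qed

lemma linear_flow_summable: "summable (\<lambda>k. (t ^ k / fact k) *\<^sub>R (L ^^ k) z)"
proof -
  obtain b where b: "\<And>x. norm (L x) \<le> b * norm x" "b > 0"
    using linear_bounded_pos[OF L] by blast
  have Lk: "norm ((L ^^ k) z) \<le> b ^ k * norm z" for k
  proof (induction k)
    case (Suc k)
    have "norm ((L ^^ Suc k) z) \<le> b * norm ((L ^^ k) z)" using b by simp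
    also have "\<dots> \<le> b * (b ^ k * norm z)" using Suc b by (intro mult_left_mono) auto
    finally show ?case by simp
  qed simp
  show ?thesis
  proof (rule summable_comparison_test)
    show "summable (\<lambda>k. (inverse (fact k) * (b * \<bar>t\<bar>) ^ k) * norm z)"
      by (intro summable_mult2 summable_exp)
    show "\<exists>N. \<forall>k\<ge>N. norm ((t ^ k / fact k) *\<^sub>R (L ^^ k) z) \<le> inverse (fact k) * (b * \<bar>t\<bar>) ^ k * norm z"
    proof (intro exI allI impI)
      fix k :: nat
      have "norm ((t ^ k / fact k) *\<^sub>R (L ^^ k) z) = (\<bar>t\<bar> ^ k / fact k) * norm ((L ^^ k) z)"
        by (simp add: power_abs)
      also have "\<dots> \<le> (\<bar>t\<bar> ^ k / fact k) * (b ^ k * norm z)"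
        by (intro mult_left_mono Lk) simp
      finally show "norm ((t ^ k / fact k) *\<^sub>R (L ^^ k) z) \<le> inverse (fact k) * (b * \<bar>t\<bar>) ^ k * norm z"
        by (simp add: power_mult_distrib divide_inverse algebra_simps)
    qed
  qed
qed

lemma linear_flow_0 [simp]: "linear_flow L 0 z = z"
proof -
  have "(\<Sum>k. (0 ^ k / fact k) *\<^sub>R (L ^^ k) z) = (\<Sum>k\<in>{0}. (0 ^ k / fact k) *\<^sub>R (L ^^ k) z)"
    by (intro suminf_finite) (auto simp: power_0_left)
  then show ?thesis by (simp add: linear_flow_eq)
qed

text \<open>Each coordinate is an everywhere convergent real power series in \<open>t\<close>.
  Differentiating termwise shifts the coefficients and gives the flow of \<open>L z\<close>, and
  \<open>L\<close> commutes with its own series.\<close>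

lemma linear_flow_has_vector_derivative:
  "((\<lambda>t. linear_flow L t z) has_vector_derivative L (linear_flow L t z)) (at t within S)"
  unfolding has_vector_derivative_def
proof (subst has_derivative_componentwise_within, intro ballI)
  fix b :: 'a
  have inner_flow: "linear_flow L t z \<bullet> b = (\<Sum>k. ((L ^^ k) z \<bullet> b / fact k) * t ^ k)" for t z
    unfolding linear_flow_eq
    using bounded_linear.suminf[OF bounded_linear_inner_left linear_flow_summable[of t z], of b]
    by (simp add: mult.commute)
  have summ: "summable (\<lambda>k. ((L ^^ k) z \<bullet> b / fact k) * t ^ k)" for t z
    using bounded_linear.summable[OF bounded_linear_inner_left linear_flow_summable[of t z], of b]
    by (simp add: mult.commute)
  have "bounded_linear L" using L by (simp add: linear_conv_bounded_linear)
  then have "L (linear_flow L t z) = (\<Sum>k. L ((t ^ k / fact k) *\<^sub>R (L ^^ k) z))"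
    unfolding linear_flow_eq by (rule bounded_linear.suminf[OF _ linear_flow_summable])
  also have "\<dots> = linear_flow L t (L z)"
    unfolding linear_flow_eq by (simp add: linear_scale[OF L] funpow_swap1)
  finally have commute: "L (linear_flow L t z) = linear_flow L t (L z)" .
  have "((\<lambda>t. \<Sum>k. ((L ^^ k) z \<bullet> b / fact k) * t ^ k) has_field_derivative
      (\<Sum>k. diffs (\<lambda>k. (L ^^ k) z \<bullet> b / fact k) k * t ^ k)) (at t)"
    by (rule termdiffs_strong_converges_everywhere[OF summ])
  also have "diffs (\<lambda>k. (L ^^ k) z \<bullet> b / fact k) = (\<lambda>k. (L ^^ k) (L z) \<bullet> b / fact k)"
    by (auto simp: diffs_def fun_eq_iff funpow_swap1 divide_simps simp del: of_nat_Suc)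
  finally have "((\<lambda>t. linear_flow L t z \<bullet> b) has_field_derivative L (linear_flow L t z) \<bullet> b) (at t)"
    by (simp add: inner_flow commute)
  then show "((\<lambda>t. linear_flow L t z \<bullet> b) has_derivative (\<lambda>s. s *\<^sub>R L (linear_flow L t z) \<bullet> b)) (at t within S)"
    by (simp add: has_real_derivative_iff_has_vector_derivative has_vector_derivative_def has_derivative_at_withinI)
qed

text \<open>Gronwall's argument: \<open>w t \<bullet> w t\<close> has a derivative of modulus at
  most \<open>2 * b\<close> times itself. An exponential weight makes it monotone, with the sign of
  the exponent chosen according to the side of \<open>0\<close>.\<close>

lemma linear_ode_zero:
  fixes w :: "real \<Rightarrow> 'a"
  assumes w: "\<And>t. (w has_vector_derivative L (w t)) (at t)" and "w 0 = 0"
  shows "w t = 0"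
proof -
  obtain b where b: "\<And>x. norm (L x) \<le> b * norm x" "b > 0"
    using linear_bounded_pos[OF L] by blast
  have wL: "\<bar>w t \<bullet> L (w t)\<bar> \<le> b * (w t \<bullet> w t)" for t
  proof -
    have "\<bar>w t \<bullet> L (w t)\<bar> \<le> norm (w t) * (b * norm (w t))"
      by (rule order_trans[OF Cauchy_Schwarz_ineq2]) (intro mult_left_mono b norm_ge_zero)
    then show ?thesis by (simp add: dot_square_norm power2_eq_square algebra_simps)
  qed
  have deriv: "((\<lambda>t. (w t \<bullet> w t) * exp (c * t)) has_field_derivative
      (2 * (w t \<bullet> L (w t)) + c * (w t \<bullet> w t)) * exp (c * t)) (at t)" for c t
  proof -
    have "((\<lambda>t. w t \<bullet> w t) has_vector_derivative (w t \<bullet> L (w t) + L (w t) \<bullet> w t)) (at t)"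
      by (rule bounded_bilinear.has_vector_derivative[OF bounded_bilinear_inner w w])
    then have 1: "((\<lambda>t. w t \<bullet> w t) has_field_derivative 2 * (w t \<bullet> L (w t))) (at t)"
      by (simp add: has_real_derivative_iff_has_vector_derivative inner_commute)
    show ?thesis
      by (rule derivative_eq_intros 1 refl | simp add: algebra_simps)+
  qed
  have "w t \<bullet> w t \<le> 0"
  proof (cases "t \<ge> 0")
    case True
    have "(w t \<bullet> w t) * exp ((- 2 * b) * t) \<le> (w 0 \<bullet> w 0) * exp ((- 2 * b) * 0)"
    proof (rule DERIV_nonpos_imp_nonincreasing[OF True], intro exI conjI)
      fix s show "(2 * (w s \<bullet> L (w s)) + (- 2 * b) * (w s \<bullet> w s)) * exp ((- 2 * b) * s) \<le> 0"
        using wL[of s] by (intro mult_nonpos_nonneg) auto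
    qed (rule deriv)
    then show ?thesis using \<open>w 0 = 0\<close> by (simp add: mult_le_0_iff)
  next
    case False
    have "(w t \<bullet> w t) * exp ((2 * b) * t) \<le> (w 0 \<bullet> w 0) * exp ((2 * b) * 0)"
    proof (rule DERIV_nonneg_imp_nondecreasing[where f = "\<lambda>t. (w t \<bullet> w t) * exp ((2 * b) * t)"], goal_cases)
      case 1
      then show ?case using False by simp
    next
      case (2 s)
      show ?case
      proof (intro exI conjI)
        show "(2 * (w s \<bullet> L (w s)) + (2 * b) * (w s \<bullet> w s)) * exp ((2 * b) * s) \<ge> 0"
          using wL[of s] by (intro mult_nonneg_nonneg) auto
      qed (rule deriv)
    qed
    then show ?thesis using \<open>w 0 = 0\<close> by (simp add: mult_le_0_iff)
  qed
  then show ?thesis by (metis inner_eq_zero_iff inner_ge_zero order_antisym)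
qed

text \<open>The difference of two solutions solves the same equation and starts at zero. Linearity
  in the starting point and the group law then follow by exhibiting a second solution.\<close>

lemma linear_flow_unique:
  fixes y :: "real \<Rightarrow> 'a"
  assumes y: "\<And>t. (y has_vector_derivative L (y t)) (at t)"
  shows "y t = linear_flow L t (y 0)"
proof -
  have "y t - linear_flow L t (y 0) = 0"
    by (rule linear_ode_zero)
      (auto intro!: derivative_eq_intros y linear_flow_has_vector_derivative simp: linear_diff[OF L])
  then show ?thesis by simp
qed

lemma linear_linear_flow: "linear (linear_flow L t)"
proof (rule linearI)
  show "linear_flow L t (x + y) = linear_flow L t x + linear_flow L t y" for x y
    by (rule linear_flow_unique[of "\<lambda>t. linear_flow L t x + linear_flow L t y" t, simplified, symmetric])
      (auto intro!: derivative_eq_intros linear_flow_has_vector_derivative simp: linear_add[OF L])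
  show "linear_flow L t (c *\<^sub>R x) = c *\<^sub>R linear_flow L t x" for c x
    by (rule linear_flow_unique[of "\<lambda>t. c *\<^sub>R linear_flow L t x" t, simplified, symmetric])
      (auto intro!: derivative_eq_intros linear_flow_has_vector_derivative simp: linear_scale[OF L])
qed

lemma linear_flow_add: "linear_flow L (s + t) z = linear_flow L s (linear_flow L t z)"
proof -
  have "((\<lambda>s. linear_flow L (s + t) z) has_vector_derivative L (linear_flow L (s + t) z)) (at s)" for s
    using vector_diff_chain_at[of "\<lambda>s. s + t" 1 s "\<lambda>s. linear_flow L s z"]
      linear_flow_has_vector_derivative[of z "s + t" UNIV]
    by (simp add: o_def has_vector_derivative_add_const)
  from linear_flow_unique[OF this, of s] show ?thesis by simp
qed

end

section \<open>The Hamiltonian flow\<close>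

lemma DERIV_at_of_inner_vector:
  fixes f g :: "real \<Rightarrow> 'a::real_inner"
  assumes "(f has_vector_derivative f') (at x within S)" "(g has_vector_derivative g') (at x within S)"
  shows "((\<lambda>t. f t \<bullet> g t) has_real_derivative f x \<bullet> g' + f' \<bullet> g x) (at x within S)"
  using bounded_bilinear.has_vector_derivative[OF bounded_bilinear_inner assms]
  by (simp add: has_real_derivative_iff_has_vector_derivative)

lemma matrix_minus_vector_mult: "(- A) *v x = - (A *v (x :: 'a::ring_1^'n))"
  by (simp add: vec_eq_iff matrix_vector_mult_def sum_negf)

lemma matrix_vector_mult_minus: "A *v (- x) = - (A *v (x :: 'a::ring_1^'n))"
  by (simp add: vec_eq_iff matrix_vector_mult_def sum_negf)

text \<open>This is \<open>- Omega_map (H_map A B Q z)\<close> multiplied out: Hamilton's equations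
  for the momentum \<open>fst z\<close> and the state \<open>snd z\<close>.\<close>

definition ham_field :: "real^'n^'n \<Rightarrow> real^'m^'n \<Rightarrow> real^'n^'n
    \<Rightarrow> (real^'n) \<times> (real^'n) \<Rightarrow> (real^'n) \<times> (real^'n)" where
  "ham_field A B Q z = (- (transpose A *v fst z) - Q *v snd z, B *v (transpose B *v fst z) + A *v snd z)"

lemma linear_ham_field: "linear (ham_field A B Q)"
  by (rule linearI)
    (simp_all add: ham_field_def matrix_vector_right_distrib matrix_vector_mult_scaleR
      scaleR_add_right scaleR_diff_right)

lemma ham_exp_eq_linear_flow: "ham_exp A B Q t z = linear_flow (ham_field A B Q) t z"
proof -
  have "(\<lambda>w. (- t) *\<^sub>R Omega_map (H_map A B Q w)) = (\<lambda>w. t *\<^sub>R ham_field A B Q w)"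
    by (auto simp: Omega_map_def H_map_def ham_field_def fun_eq_iff matrix_vector_mul_assoc
        scaleR_add_right scaleR_diff_right simp del: transpose_matrix_vector)
  then show ?thesis by (simp add: ham_exp_def linear_flow_def)
qed

definition R1 :: "real^'n^'n \<Rightarrow> real^'m^'n \<Rightarrow> real^'n^'n \<Rightarrow> real \<Rightarrow> real^'n^'n" where
  "R1 A B Q \<tau> = matrix (\<lambda>p. fst (ham_exp A B Q \<tau> (p, 0)))"

definition R2 :: "real^'n^'n \<Rightarrow> real^'m^'n \<Rightarrow> real^'n^'n \<Rightarrow> real \<Rightarrow> real^'n^'n" where
  "R2 A B Q \<tau> = matrix (\<lambda>x. fst (ham_exp A B Q \<tau> (0, x)))"

definition symplectic_form :: "'a::real_inner \<times> 'a \<Rightarrow> 'a \<times> 'a \<Rightarrow> real" where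
  "symplectic_form z w = fst z \<bullet> snd w - snd z \<bullet> fst w"

locale lq_system =
  fixes A Q :: "real^'n^'n" and B :: "real^'m^'n"
  assumes Q_symmetric: "transpose Q = Q"
begin

abbreviation "\<Phi> \<equiv> ham_exp A B Q"
abbreviation "r1 \<equiv> R1 A B Q"
abbreviation "r2 \<equiv> R2 A B Q"
abbreviation "r3 \<equiv> R3 A B Q"
abbreviation "r4 \<equiv> R4 A B Q"

lemma flow_has_vector_derivative:
  "((\<lambda>t. \<Phi> t z) has_vector_derivative ham_field A B Q (\<Phi> t z)) (at t within S)"
  unfolding ham_exp_eq_linear_flow
  by (rule linear_flow_has_vector_derivative[OF linear_ham_field])

lemma flow_0 [simp]: "\<Phi> 0 z = z"
  by (simp add: ham_exp_eq_linear_flow linear_flow_0[OF linear_ham_field])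

lemma flow_add: "\<Phi> (s + t) z = \<Phi> s (\<Phi> t z)"
  by (simp add: ham_exp_eq_linear_flow linear_flow_add[OF linear_ham_field])

lemma flow_blocks: "\<Phi> t (p, x) = (r1 t *v p + r2 t *v x, r3 t *v p + r4 t *v x)"
proof -
  have lin: "linear (\<Phi> t)"
    using linear_linear_flow[OF linear_ham_field] by (simp add: ham_exp_eq_linear_flow[abs_def])
  have "linear (\<lambda>p. \<Phi> t (p, 0))" "linear (\<lambda>x. \<Phi> t (0, x))"
    by (auto intro!: linearI simp: linear_add[OF lin, symmetric] linear_scale[OF lin, symmetric])
  then have l: "linear (\<lambda>p. fst (\<Phi> t (p, 0)))" "linear (\<lambda>x. fst (\<Phi> t (0, x)))"
    "linear (\<lambda>p. snd (\<Phi> t (p, 0)))" "linear (\<lambda>x. snd (\<Phi> t (0, x)))"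
    by (auto intro: linear_compose[unfolded o_def] linear_fst linear_snd)
  have "\<Phi> t (p, x) = \<Phi> t (p, 0) + \<Phi> t (0, x)"
    by (simp add: linear_add[OF lin, symmetric])
  moreover have "matrix f *v y = f y" if "linear f" for f :: "real^'n \<Rightarrow> real^'n" and y
    using that by (simp add: matrix_works linear_matrix_vector_mul_eq)
  ultimately show ?thesis
    using l by (simp add: prod_eq_iff R1_def R2_def R3_def R4_def)
qed

lemma flow_fst: "fst (\<Phi> t z) = r1 t *v fst z + r2 t *v snd z"
  and flow_snd: "snd (\<Phi> t z) = r3 t *v fst z + r4 t *v snd z"
  using flow_blocks[of t "fst z" "snd z"] by simp_all

lemma momentum_has_vector_derivative:
  "((\<lambda>t. fst (\<Phi> t z)) has_vector_derivative - (transpose A *v fst (\<Phi> t z)) - Q *v snd (\<Phi> t z)) (at t within S)"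
  using bounded_linear.has_vector_derivative[OF bounded_linear_fst flow_has_vector_derivative]
  by (simp add: ham_field_def)

lemma state_has_vector_derivative:
  "((\<lambda>t. snd (\<Phi> t z)) has_vector_derivative B *v (transpose B *v fst (\<Phi> t z)) + A *v snd (\<Phi> t z)) (at t within S)"
  using bounded_linear.has_vector_derivative[OF bounded_linear_snd flow_has_vector_derivative]
  by (simp add: ham_field_def)

lemma block_mult_vector:
  "r1 t *v v = fst (\<Phi> t (v, 0))" "r2 t *v v = fst (\<Phi> t (0, v))"
  "r3 t *v v = snd (\<Phi> t (v, 0))" "r4 t *v v = snd (\<Phi> t (0, v))"
  by (simp_all add: flow_fst flow_snd)

lemma blocks_at_0 [simp]: "r1 0 = mat 1" "r2 0 = 0" "r3 0 = 0" "r4 0 = mat 1"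
  by (simp_all add: matrix_eq block_mult_vector)

lemma blocks_has_vector_derivative:
  shows r1_has_vector_derivative: "(r1 has_vector_derivative - (transpose A ** r1 t) - Q ** r3 t) (at t within S)"
    and r2_has_vector_derivative: "(r2 has_vector_derivative - (transpose A ** r2 t) - Q ** r4 t) (at t within S)"
    and r3_has_vector_derivative: "(r3 has_vector_derivative B ** transpose B ** r1 t + A ** r3 t) (at t within S)"
    and r4_has_vector_derivative: "(r4 has_vector_derivative B ** transpose B ** r2 t + A ** r4 t) (at t within S)"
proof -
  note e = matrix_vector_mult_diff_rdistrib matrix_vector_mult_add_rdistrib matrix_minus_vector_mult
    matrix_vector_mul_assoc[symmetric]
  show "(r1 has_vector_derivative - (transpose A ** r1 t) - Q ** r3 t) (at t within S)"
    by (rule has_vector_derivative_matrix) (simp only: e block_mult_vector momentum_has_vector_derivative)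
  show "(r2 has_vector_derivative - (transpose A ** r2 t) - Q ** r4 t) (at t within S)"
    by (rule has_vector_derivative_matrix) (simp only: e block_mult_vector momentum_has_vector_derivative)
  show "(r3 has_vector_derivative B ** transpose B ** r1 t + A ** r3 t) (at t within S)"
    by (rule has_vector_derivative_matrix) (simp only: e block_mult_vector state_has_vector_derivative)
  show "(r4 has_vector_derivative B ** transpose B ** r2 t + A ** r4 t) (at t within S)"
    by (rule has_vector_derivative_matrix) (simp only: e block_mult_vector state_has_vector_derivative)
qed

text \<open>In the time derivative the terms with \<open>A\<close> cancel against those with its
  transpose, and the terms with \<open>Q\<close> and with \<open>B ** transpose B\<close> cancel by
  symmetry.\<close>

lemma flow_symplectic: "symplectic_form (\<Phi> t z) (\<Phi> t w) = symplectic_form z w"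
proof -
  have "((\<lambda>t. symplectic_form (\<Phi> t z) (\<Phi> t w)) has_real_derivative 0) (at t)" for t
    unfolding symplectic_form_def
    by (rule derivative_eq_intros DERIV_at_of_inner_vector momentum_has_vector_derivative
        state_has_vector_derivative refl)+
      (use inner_matrix_vector_mult_symmetric[OF Q_symmetric, of "snd (\<Phi> t w)" "snd (\<Phi> t z)"]
        in \<open>simp add: inner_add_left inner_add_right inner_diff_left inner_diff_right inner_commute\<close>,
       simp add: inner_commute flip: dot_lmul_matrix)
  then have "symplectic_form (\<Phi> t z) (\<Phi> t w) = symplectic_form (\<Phi> 0 z) (\<Phi> 0 w)"
    by (intro DERIV_isconst_all) auto
  then show ?thesis by simp
qed

text \<open>Invariance moves the flow from one argument of the symplectic form to the other with
  time reversed; on points of state zero only the block \<open>r3\<close> is seen.\<close>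

lemma r3_minus: "r3 (- t) = - transpose (r3 t)"
proof -
  have "p \<bullet> (r3 (- t) *v q) = p \<bullet> (- transpose (r3 t) *v q)" for p q
  proof -
    have "symplectic_form (\<Phi> t (p, 0)) (q, 0) = symplectic_form (\<Phi> t (p, 0)) (\<Phi> t (\<Phi> (- t) (q, 0)))"
      using flow_add[of t "- t" "(q, 0)"] by simp
    also have "\<dots> = symplectic_form (p, 0) (\<Phi> (- t) (q, 0))"
      by (rule flow_symplectic)
    finally show ?thesis
      by (simp add: symplectic_form_def flow_fst flow_snd matrix_minus_vector_mult inner_matrix_vector_mult)
  qed
  then show ?thesis by (metis matrix_eq vector_eq_ldot)
qed

text \<open>Arguing by invertibility avoids the sign of the determinant, which depends on the parity
  of the dimension.\<close>

lemma det_r3_minus: "det (r3 (- t)) \<noteq> 0 \<longleftrightarrow> det (r3 t) \<noteq> 0"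
proof -
  have "invertible (- transpose (r3 t)) \<longleftrightarrow> invertible (transpose (r3 t))"
    unfolding invertible_left_inverse matrix_left_invertible_ker
    by (simp add: matrix_minus_vector_mult)
  then show ?thesis by (simp add: r3_minus invertible_det_nz)
qed

text \<open>The gradient of \<open>c\<^bsup>0,t\<^esup>(\<cdot>, y)\<close> at \<open>x\<close> is \<open>- p\<close>, where \<open>r3 t *v p + r4 t *v x = y\<close>.\<close>
definition cost_hessian :: "real \<Rightarrow> real^'n^'n" where
  "cost_hessian t = matrix_inv (r3 t) ** r4 t"

lemma r3_cost_hessian: "det (r3 t) \<noteq> 0 \<Longrightarrow> r3 t *v (cost_hessian t *v v) = r4 t *v v"
  by (simp add: cost_hessian_def matrix_inv_vector_right flip: matrix_vector_mul_assoc)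

text \<open>The momentum \<open>- (cost_hessian s *v v)\<close> steers the state from
  \<open>v\<close> to the origin at time \<open>s\<close>. Running the flow back from there
  determines the final momentum through \<open>r3 (- s)\<close>.\<close>

lemma flow_focusing:
  assumes "det (r3 s) \<noteq> 0"
  shows "\<Phi> s (- (cost_hessian s *v v), v) = (matrix_inv (r3 (- s)) *v v, 0)"
proof -
  have snd: "snd (\<Phi> s (- (cost_hessian s *v v), v)) = 0"
    by (simp add: flow_snd matrix_vector_mult_minus r3_cost_hessian[OF assms])
  define p where "p = fst (\<Phi> s (- (cost_hessian s *v v), v))"
  have s: "\<Phi> s (- (cost_hessian s *v v), v) = (p, 0)" using snd by (simp add: p_def prod_eq_iff)
  have "\<Phi> (- s) (p, 0) = (- (cost_hessian s *v v), v)"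
    using flow_add[of "- s" s "(- (cost_hessian s *v v), v)"] s by simp
  then have "r3 (- s) *v p = v" by (simp add: block_mult_vector)
  then have "matrix_inv (r3 (- s)) *v v = p"
    using assms matrix_inv_vector_left[of "r3 (- s)" p] by (simp add: det_r3_minus)
  then show ?thesis using s by simp
qed

text \<open>The focusing trajectory has state zero at time \<open>s\<close>, so its state at any
  other time is given by \<open>r3 (t - s)\<close> alone. This is the source of the first term of
  the final inequality.\<close>

lemma r4_minus_r3_cost_hessian:
  assumes "det (r3 s) \<noteq> 0"
  shows "r4 t - r3 t ** cost_hessian s = r3 (t - s) ** matrix_inv (r3 (- s))"
proof -
  have "(r4 t - r3 t ** cost_hessian s) *v v = (r3 (t - s) ** matrix_inv (r3 (- s))) *v v" for v
  proof -
    have "\<Phi> t (- (cost_hessian s *v v), v) = \<Phi> (t - s) (matrix_inv (r3 (- s)) *v v, 0)"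
      using flow_add[of "t - s" s] flow_focusing[OF assms, of v] by simp
    from arg_cong[OF this, of snd] show ?thesis
      by (simp add: flow_snd matrix_vector_mult_minus matrix_vector_mult_diff_rdistrib
          flip: matrix_vector_mul_assoc)
  qed
  then show ?thesis by (simp add: matrix_eq)
qed

text \<open>The focusing initial points are all carried to state zero, where the symplectic form
  vanishes. By invariance they form a Lagrangian subspace, and as this is the graph of
  \<open>- cost_hessian t\<close> the matrix is symmetric.\<close>

lemma cost_hessian_symmetric:
  assumes "det (r3 t) \<noteq> 0"
  shows "transpose (cost_hessian t) = cost_hessian t"
proof (rule symmetric_matrixI)
  fix x y
  have "symplectic_form (- (cost_hessian t *v x), x) (- (cost_hessian t *v y), y) = 0"
    using flow_symplectic[of t "(- (cost_hessian t *v x), x)" "(- (cost_hessian t *v y), y)"]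
    by (simp add: flow_focusing[OF assms] symplectic_form_def)
  then show "x \<bullet> (cost_hessian t *v y) = y \<bullet> (cost_hessian t *v x)"
    by (simp add: symplectic_form_def inner_commute)
qed

text \<open>The terms with \<open>A\<close> cancel because \<open>r3 t\<close> maps
  \<open>cost_hessian t *v v\<close> to \<open>r4 t *v v\<close>. What is left contains the final
  momentum \<open>?q\<close> of the focusing trajectory, which produces a negative square.\<close>

lemma cost_hessian_has_derivative:
  assumes "det (r3 t) \<noteq> 0"
  shows "((\<lambda>t. v \<bullet> (cost_hessian t *v v)) has_real_derivative
    - (norm (transpose B *v (transpose (matrix_inv (r3 t)) *v v)))\<^sup>2) (at t within S)"
proof -
  let ?Y = "matrix_inv (r3 t)" and ?S = "cost_hessian t" and ?q = "matrix_inv (r3 (- t)) *v v"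
  have "(cost_hessian has_vector_derivative ?Y ** (B ** transpose B ** r2 t + A ** r4 t)
      + - (?Y ** (B ** transpose B ** r1 t + A ** r3 t) ** ?Y) ** r4 t) (at t within S)"
    unfolding cost_hessian_def[abs_def]
    by (intro bounded_bilinear.has_vector_derivative[OF bounded_bilinear_matrix_matrix_mult]
        has_vector_derivative_matrix_inv r3_has_vector_derivative r4_has_vector_derivative assms)
  from bounded_bilinear.has_vector_derivative[OF bounded_bilinear_matrix_vector_mult this has_vector_derivative_const, of v]
  have "((\<lambda>t. cost_hessian t *v v) has_vector_derivative
      ?Y *v (B *v (transpose B *v (r2 t *v v)) + A *v (r4 t *v v))
      - ?Y *v (B *v (transpose B *v (r1 t *v (?S *v v))) + A *v (r3 t *v (?S *v v)))) (at t within S)"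
    by (simp add: cost_hessian_def matrix_vector_mult_add_rdistrib matrix_minus_vector_mult
        flip: matrix_vector_mul_assoc)
  also have "?Y *v (B *v (transpose B *v (r2 t *v v)) + A *v (r4 t *v v))
      - ?Y *v (B *v (transpose B *v (r1 t *v (?S *v v))) + A *v (r3 t *v (?S *v v)))
    = ?Y *v (B *v (transpose B *v (r2 t *v v - r1 t *v (?S *v v))))"
    by (simp add: r3_cost_hessian[OF assms] matrix_vector_mult_diff_distrib matrix_vector_right_distrib)
  also have "r2 t *v v - r1 t *v (?S *v v) = ?q"
    using arg_cong[OF flow_focusing[OF assms, of v], of fst] by (simp add: flow_fst matrix_vector_mult_minus)
  \<comment> \<open>By \<open>r3_minus\<close>, inverting \<open>r3 (- t)\<close> is, up to sign,
    applying the transposed inverse of \<open>r3 t\<close>.\<close>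
  also have "?q = - (transpose ?Y *v v)"
  proof -
    have "r3 (- t) *v ?q = v"
      using assms by (simp add: matrix_inv_vector_right det_r3_minus)
    then have "v = - (transpose (r3 t) *v ?q)" by (simp add: r3_minus matrix_minus_vector_mult)
    then have "transpose ?Y *v v = - ((transpose ?Y ** transpose (r3 t)) *v ?q)"
      by (metis matrix_vector_mul_assoc matrix_vector_mult_minus)
    also have "\<dots> = - ?q"
      by (simp add: matrix_inv_right_mult[OF assms] transpose_mat flip: matrix_transpose_mul)
    finally show ?thesis by simp
  qed
  finally have "((\<lambda>t. v \<bullet> (cost_hessian t *v v)) has_real_derivative
      v \<bullet> (?Y *v (B *v (transpose B *v - (transpose ?Y *v v)))) + 0 \<bullet> (?S *v v)) (at t within S)"
    by (intro DERIV_at_of_inner_vector has_vector_derivative_const)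
  moreover have "v \<bullet> (?Y *v (B *v (transpose B *v - (transpose ?Y *v v)))) + 0 \<bullet> (?S *v v)
      = - (norm (transpose B *v (transpose ?Y *v v)))\<^sup>2"
    by (simp add: power2_norm_eq_inner matrix_vector_mult_minus flip: dot_lmul_matrix)
  ultimately show ?thesis by simp
qed

lemma cost_hessian_antimono:
  assumes "0 < t" "t \<le> s" "\<And>r. 0 < r \<Longrightarrow> r \<le> s \<Longrightarrow> det (r3 r) \<noteq> 0"
  shows "v \<bullet> (cost_hessian s *v v) \<le> v \<bullet> (cost_hessian t *v v)"
proof (rule DERIV_nonpos_imp_nonincreasing[OF assms(2)])
  fix r assume "t \<le> r" "r \<le> s"
  then have "det (r3 r) \<noteq> 0" using assms by simp
  from cost_hessian_has_derivative[OF this]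
  show "\<exists>y. ((\<lambda>t. v \<bullet> (cost_hessian t *v v)) has_real_derivative y) (at r) \<and> y \<le> 0"
    by (intro exI conjI) auto
qed

section \<open>Riccati solutions regular up to time zero\<close>

text \<open>It gives the states of the extremals with initial data
  \<open>(p, d *\<^sub>R p)\<close>. Unlike \<open>r3\<close>, it is regular at time
  \<open>0\<close> when \<open>d\<close> is nonzero.\<close>

definition riccati_denominator :: "real \<Rightarrow> real \<Rightarrow> real^'n^'n" where
  "riccati_denominator d t = r3 t + d *\<^sub>R r4 t"

text \<open>Where the denominator is regular, this matrix sends the state to the momentum along
  those extremals.\<close>

definition riccati :: "real \<Rightarrow> real \<Rightarrow> real^'n^'n" where
  "riccati d t = (r1 t + d *\<^sub>R r2 t) ** matrix_inv (riccati_denominator d t)"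

text \<open>The initial points \<open>(u, d *\<^sub>R u)\<close> form a Lagrangian subspace, the
  flow preserves this property, and at time \<open>t\<close> the subspace is the graph of
  \<open>riccati d t\<close> over the states.\<close>

lemma riccati_symmetric:
  assumes "det (riccati_denominator d t) \<noteq> 0"
  shows "transpose (riccati d t) = riccati d t"
proof (rule symmetric_matrixI)
  fix x y
  define v w where "v = matrix_inv (riccati_denominator d t) *v x" "w = matrix_inv (riccati_denominator d t) *v y"
  have flow: "\<Phi> t (u, d *\<^sub>R u) = (riccati d t *v (riccati_denominator d t *v u), riccati_denominator d t *v u)" for u
    using matrix_inv_vector_left[OF assms, of u]
    by (simp add: riccati_def riccati_denominator_def flow_blocks matrix_vector_mult_add_rdistrib
        matrix_vector_mult_scaleR scaleR_matrix_vector_assoc flip: matrix_vector_mul_assoc)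
  have x: "riccati_denominator d t *v v = x" and y: "riccati_denominator d t *v w = y"
    by (simp_all add: v_w_def matrix_inv_vector_right[OF assms])
  have "symplectic_form (\<Phi> t (v, d *\<^sub>R v)) (\<Phi> t (w, d *\<^sub>R w)) = 0"
    unfolding flow_symplectic by (simp add: symplectic_form_def)
  then show "x \<bullet> (riccati d t *v y) = y \<bullet> (riccati d t *v x)"
    unfolding flow x y by (simp add: symplectic_form_def inner_commute)
qed

lemma riccati_denominator_has_vector_derivative:
  "(riccati_denominator d has_vector_derivative
    B ** transpose B ** (r1 t + d *\<^sub>R r2 t) + A ** riccati_denominator d t) (at t within S)"
proof -
  interpret mm: bounded_bilinear "(**) :: real^'n^'n \<Rightarrow> real^'n^'n \<Rightarrow> real^'n^'n"
    by (rule bounded_bilinear_matrix_matrix_mult)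
  show ?thesis
    unfolding riccati_denominator_def[abs_def]
    by (rule derivative_eq_intros r3_has_vector_derivative r4_has_vector_derivative refl)+
      (simp add: mm.add_right mm.scaleR_right scaleR_add_right)
qed

text \<open>The quotient rule: the numerator contributes the terms with \<open>transpose A\<close>
  and \<open>Q\<close>, the inverse of the denominator those with \<open>A\<close> and the quadratic
  one.\<close>

lemma riccati_has_vector_derivative:
  assumes det: "det (riccati_denominator d t) \<noteq> 0"
  shows "(riccati d has_vector_derivative - (transpose A ** riccati d t) - riccati d t ** A - Q
    - riccati d t ** (B ** transpose B) ** riccati d t) (at t within S)"
proof -
  interpret mm: bounded_bilinear "(**) :: real^'n^'n \<Rightarrow> real^'n^'n \<Rightarrow> real^'n^'n"
    by (rule bounded_bilinear_matrix_matrix_mult)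
  let ?X = "riccati_denominator d t"
  define P where "P = r1 t + d *\<^sub>R r2 t"
  have K: "riccati d t = P ** matrix_inv ?X" by (simp add: riccati_def P_def)
  have "((\<lambda>t. r1 t + d *\<^sub>R r2 t) has_vector_derivative - (transpose A ** P) - Q ** ?X) (at t within S)"
    by (rule derivative_eq_intros r1_has_vector_derivative r2_has_vector_derivative refl)+
      (simp add: P_def riccati_denominator_def mm.add_right mm.scaleR_right scaleR_diff_right)
  then have "(riccati d has_vector_derivative
      P ** - (matrix_inv ?X ** (B ** transpose B ** P + A ** ?X) ** matrix_inv ?X)
      + (- (transpose A ** P) - Q ** ?X) ** matrix_inv ?X) (at t within S)"
    unfolding riccati_def[abs_def] P_def
    by (intro mm.has_vector_derivative has_vector_derivative_matrix_inv
        riccati_denominator_has_vector_derivative det)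
  also have "P ** - (matrix_inv ?X ** (B ** transpose B ** P + A ** ?X) ** matrix_inv ?X)
      + (- (transpose A ** P) - Q ** ?X) ** matrix_inv ?X =
      - (transpose A ** riccati d t) - riccati d t ** A - Q - riccati d t ** (B ** transpose B) ** riccati d t"
    using matrix_inv_right_mult[OF det]
    by (simp add: K mm.add_left mm.add_right mm.diff_left mm.diff_right mm.minus_left mm.minus_right
        matrix_mul_assoc[symmetric])
  finally show ?thesis .
qed

text \<open>At positive times the denominator is \<open>r3 t\<close> times
  \<open>mat 1 + d *\<^sub>R cost_hessian t\<close>. Since \<open>cost_hessian t\<close> dominates
  \<open>cost_hessian T\<close>, one small \<open>d\<close> makes the second factor positive
  definite for all these times at once.\<close>

lemma regular_riccati_denominator:
  assumes T: "0 < T" and nz: "\<And>r. 0 < r \<Longrightarrow> r \<le> T \<Longrightarrow> det (r3 r) \<noteq> 0"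
  obtains d where "d > 0"
    "\<And>t. 0 \<le> t \<Longrightarrow> t \<le> T \<Longrightarrow> 0 < det (riccati_denominator d t)"
    "\<And>t. 0 < t \<Longrightarrow> t \<le> T \<Longrightarrow> 0 < det (r3 t)"
proof -
  obtain b where b: "\<And>v. norm (cost_hessian T *v v) \<le> b * norm v" "b > 0"
    using linear_bounded_pos[OF matrix_vector_mul_linear] by blast
  \<comment> \<open>As \<open>b\<close> bounds \<open>cost_hessian T\<close>, this choice leaves at
    least half of \<open>(norm v)\<^sup>2\<close> in the form of \<open>I t\<close>.\<close>
  define d where "d = 1 / (2 * b)"
  have d: "d > 0" "d * b = 1 / 2" using b by (auto simp: d_def)
  define I where "I t = mat 1 + d *\<^sub>R cost_hessian t" for t
  have I_mult: "I t *v v = v + d *\<^sub>R (cost_hessian t *v v)" for t v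
    by (simp add: I_def matrix_vector_mult_add_rdistrib scaleR_matrix_vector_assoc)
  have I_pos: "0 < v \<bullet> (I t *v v)" if t: "0 < t" "t \<le> T" and "v \<noteq> 0" for t v
  proof -
    have "- (b * (norm v)\<^sup>2) \<le> v \<bullet> (cost_hessian T *v v)"
    proof -
      have "\<bar>v \<bullet> (cost_hessian T *v v)\<bar> \<le> norm v * (b * norm v)"
        by (rule order_trans[OF Cauchy_Schwarz_ineq2]) (intro mult_left_mono b norm_ge_zero)
      then show ?thesis by (simp add: power2_eq_square algebra_simps)
    qed
    also have "\<dots> \<le> v \<bullet> (cost_hessian t *v v)"
      using t nz by (intro cost_hessian_antimono) auto
    finally have "d * (- (b * (norm v)\<^sup>2)) \<le> d * (v \<bullet> (cost_hessian t *v v))"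
      using d by (intro mult_left_mono) auto
    then have "- ((norm v)\<^sup>2 / 2) \<le> d * (v \<bullet> (cost_hessian t *v v))"
      using d(2) by (simp add: mult.assoc[symmetric])
    moreover have "0 < (norm v)\<^sup>2" using \<open>v \<noteq> 0\<close> by simp
    moreover have "v \<bullet> (I t *v v) = (norm v)\<^sup>2 + d * (v \<bullet> (cost_hessian t *v v))"
      by (simp add: I_mult inner_add_right power2_norm_eq_inner)
    ultimately show ?thesis by linarith
  qed
  have factor: "riccati_denominator d t = r3 t ** I t" if "0 < t" "t \<le> T" for t
    using r3_cost_hessian[OF nz[OF that]]
    by (simp add: matrix_eq I_mult riccati_denominator_def matrix_vector_mult_add_rdistrib
        matrix_vector_right_distrib matrix_vector_mult_scaleR
        flip: matrix_vector_mul_assoc scaleR_matrix_vector_assoc)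
  have "transpose (I t) = I t" if "0 < t" "t \<le> T" for t
    using inner_matrix_vector_mult_symmetric[OF cost_hessian_symmetric[OF nz[OF that]]]
    by (intro symmetric_matrixI) (simp add: I_mult inner_add_right inner_commute)
  \<comment> \<open>The zero matrix serves as the semidefinite partner in
    \<open>det_positive_definite\<close>.\<close>
  then have det_I: "0 < det (I t)" if "0 < t" "t \<le> T" for t
    using I_pos that by (intro det_positive_definite[where N = 0]) (auto simp: transpose_def vec_eq_iff)
  have at_0: "det (riccati_denominator d 0) = d ^ CARD('n)"
  proof -
    have "riccati_denominator d 0 = (\<chi> i j. if i = j then d else 0)"
      by (simp add: riccati_denominator_def mat_def vec_eq_iff)
    then show ?thesis by (simp add: det_diagonal)
  qed
  have nonzero: "det (riccati_denominator d t) \<noteq> 0" if "0 \<le> t" "t \<le> T" for t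
  proof (cases "t = 0")
    case True
    then show ?thesis using at_0 d by simp
  next
    case False
    then show ?thesis using that nz[of t] det_I[of t] by (simp add: factor det_mul)
  qed
  have cont: "continuous_on S (\<lambda>t. det (riccati_denominator d t))" for S
    unfolding continuous_on_def
    using has_vector_derivative_continuous[OF riccati_denominator_has_vector_derivative]
    by (auto intro!: tendsto_det simp: continuous_within)
  \<comment> \<open>The determinant is positive at time \<open>0\<close>, continuous and never zero,
    so it keeps its sign. Dividing by \<open>det (I t)\<close> then gives the sign of
    \<open>det (r3 t)\<close>.\<close>
  have pos: "0 < det (riccati_denominator d t)" if "0 \<le> t" "t \<le> T" for t
  proof (rule ccontr)
    assume neg: "\<not> ?thesis"
    have "\<exists>r\<ge>0. r \<le> t \<and> det (riccati_denominator d r) = 0"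
    proof (rule IVT2')
      show "det (riccati_denominator d t) \<le> 0" using neg by simp
      show "0 \<le> det (riccati_denominator d 0)" using at_0 d by simp
    qed (use that cont in auto)
    then obtain r where "0 \<le> r" "r \<le> t" "det (riccati_denominator d r) = 0" by blast
    then show False using nonzero[of r] that by simp
  qed
  show thesis
  proof
    show "0 < det (r3 t)" if "0 < t" "t \<le> T" for t
      using pos[of t] det_I[OF that] that by (simp add: factor det_mul zero_less_mult_iff)
  qed (use d pos in auto)
qed

end

section \<open>Products of absolutely continuous functions\<close>

text \<open>Fubini's theorem for \<open>f s * g r\<close> on the two half-planes
  \<open>s \<le> r\<close> and \<open>r < s\<close>: each contributes one term of the sum.\<close>

lemma integral_product_triangles:
  fixes f g :: "real \<Rightarrow> real"
  assumes f: "integrable lborel f" and g: "integrable lborel g"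
  shows "integrable lborel (\<lambda>r. (LINT s:{..r}|lborel. f s) * g r)"
    and "(\<integral>r. (LINT s:{..r}|lborel. f s) * g r \<partial>lborel) + (\<integral>s. f s * (LINT r:{..s}|lborel. g r) \<partial>lborel)
      = (\<integral>s. f s \<partial>lborel) * (\<integral>r. g r \<partial>lborel)"
proof -
  have [measurable]: "f \<in> borel_measurable borel" "g \<in> borel_measurable borel"
    using f g by (auto dest: borel_measurable_integrable)
  have fg: "integrable (lborel \<Otimes>\<^sub>M lborel) (\<lambda>(s, r). f s * g r)"
    by (rule lborel_pair.Fubini_integrable) (use f g in \<open>auto simp: abs_mult\<close>)
  have low: "integrable (lborel \<Otimes>\<^sub>M lborel) (\<lambda>(s, r). if s \<le> r then f s * g r else 0)"
    by (rule Bochner_Integration.integrable_bound[OF fg]) auto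
  have up: "integrable (lborel \<Otimes>\<^sub>M lborel) (\<lambda>(s, r). if s \<le> r then 0 else f s * g r)"
    by (rule Bochner_Integration.integrable_bound[OF fg]) auto
  have inner_low: "(\<integral>s. (if s \<le> r then f s * g r else 0) \<partial>lborel) = (LINT s:{..r}|lborel. f s) * g r" for r
  proof -
    have "(\<integral>s. (if s \<le> r then f s * g r else 0) \<partial>lborel) = (\<integral>s. (indicator {..r} s *\<^sub>R f s) * g r \<partial>lborel)"
      by (intro Bochner_Integration.integral_cong) (auto simp: indicator_def)
    then show ?thesis by (simp add: set_lebesgue_integral_def)
  qed
  have inner_up: "(\<integral>r. (if s \<le> r then 0 else f s * g r) \<partial>lborel) = f s * (LINT r:{..s}|lborel. g r)" for s
  proof -
    have "(\<integral>r. (if s \<le> r then 0 else f s * g r) \<partial>lborel) = (\<integral>r. f s * (indicator {..s} r *\<^sub>R g r) \<partial>lborel)"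
    proof (rule integral_cong_AE)
      \<comment> \<open>The integrands can differ only at \<open>r = s\<close>, a null set.\<close>
      show "AE r in lborel. (if s \<le> r then 0 else f s * g r) = f s * (indicator {..s} r *\<^sub>R g r)"
        using AE_lborel_singleton[of s] by eventually_elim (auto simp: indicator_def)
    qed auto
    then show ?thesis by (simp add: set_lebesgue_integral_def)
  qed
  show "integrable lborel (\<lambda>r. (LINT s:{..r}|lborel. f s) * g r)"
    using lborel_pair.integrable_snd[OF low] by (simp add: inner_low)
  have "(\<integral>s. f s \<partial>lborel) * (\<integral>r. g r \<partial>lborel) = (\<integral>s. (\<integral>r. f s * g r \<partial>lborel) \<partial>lborel)"
    by simp
  also have "\<dots> = integral\<^sup>L (lborel \<Otimes>\<^sub>M lborel) (\<lambda>(s, r). f s * g r)"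
    by (rule lborel_pair.integral_fst[OF fg])
  also have "\<dots> = integral\<^sup>L (lborel \<Otimes>\<^sub>M lborel)
      (\<lambda>z. (case z of (s, r) \<Rightarrow> if s \<le> r then f s * g r else 0) + (case z of (s, r) \<Rightarrow> if s \<le> r then 0 else f s * g r))"
    by (intro Bochner_Integration.integral_cong) auto
  also have "\<dots> = integral\<^sup>L (lborel \<Otimes>\<^sub>M lborel) (\<lambda>(s, r). if s \<le> r then f s * g r else 0)
      + integral\<^sup>L (lborel \<Otimes>\<^sub>M lborel) (\<lambda>(s, r). if s \<le> r then 0 else f s * g r)"
    by (rule Bochner_Integration.integral_add[OF low up])
  also have "\<dots> = (\<integral>r. (LINT s:{..r}|lborel. f s) * g r \<partial>lborel) + (\<integral>s. f s * (LINT r:{..s}|lborel. g r) \<partial>lborel)"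
    by (simp add: lborel_pair.integral_snd[OF low, symmetric] inner_low lborel_pair.integral_fst[OF up, symmetric] inner_up)
  finally show "(\<integral>r. (LINT s:{..r}|lborel. f s) * g r \<partial>lborel) + (\<integral>s. f s * (LINT r:{..s}|lborel. g r) \<partial>lborel)
      = (\<integral>s. f s \<partial>lborel) * (\<integral>r. g r \<partial>lborel)" by simp
qed

text \<open>Absolute continuity in integral form. Admissible trajectories satisfy their equation
  only in this sense, so pointwise differentiation rules do not apply to them.\<close>

definition primitive_on :: "real \<Rightarrow> (real \<Rightarrow> real) \<Rightarrow> (real \<Rightarrow> real) \<Rightarrow> bool" where
  "primitive_on T F f \<longleftrightarrow> set_integrable lborel {0..T} f \<and>
     (\<forall>t\<in>{0..T}. F t = F 0 + (LINT s:{0..t}|lborel. f s))"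

lemma primitive_onD:
  assumes "primitive_on T F f" "t \<in> {0..T}"
  shows "set_integrable lborel {0..t} f" "F t = F 0 + (LINT s:{0..t}|lborel. f s)"
proof -
  show "set_integrable lborel {0..t} f"
    by (rule set_integrable_subset[of _ "{0..T}"]) (use assms in \<open>auto simp: primitive_on_def\<close>)
  show "F t = F 0 + (LINT s:{0..t}|lborel. f s)"
    using assms unfolding primitive_on_def by blast
qed

lemma primitive_onI:
  assumes "\<And>t. t \<in> {0..T} \<Longrightarrow> set_integrable lborel {0..t} f"
    and "\<And>t. t \<in> {0..T} \<Longrightarrow> F t = F 0 + (LINT s:{0..t}|lborel. f s)"
  shows "primitive_on T F f"
proof -
  have "set_integrable lborel {0..T} f"
    using assms(1)[of T] by (cases "0 \<le> T") (simp_all add: set_integrable_def)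
  then show ?thesis unfolding primitive_on_def using assms(2) by blast
qed

lemma primitive_on_const: "primitive_on T (\<lambda>_. c) (\<lambda>_. 0)"
  by (rule primitive_onI) (simp_all add: set_integrable_def set_lebesgue_integral_def)

lemma primitive_on_add:
  assumes F: "primitive_on T F f" and G: "primitive_on T G g"
  shows "primitive_on T (\<lambda>t. F t + G t) (\<lambda>t. f t + g t)"
proof (rule primitive_onI)
  fix t assume t: "t \<in> {0..T}"
  show "set_integrable lborel {0..t} (\<lambda>t. f t + g t)"
    using primitive_onD(1)[OF F t] primitive_onD(1)[OF G t] by (rule set_integral_add)
  show "F t + G t = F 0 + G 0 + (LINT s:{0..t}|lborel. f s + g s)"
    unfolding set_integral_add(2)[OF primitive_onD(1)[OF F t] primitive_onD(1)[OF G t]]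
    using primitive_onD(2)[OF F t] primitive_onD(2)[OF G t] by linarith
qed

lemma primitive_on_sum:
  assumes "\<And>i. i \<in> I \<Longrightarrow> primitive_on T (F i) (f i)"
  shows "primitive_on T (\<lambda>t. \<Sum>i\<in>I. F i t) (\<lambda>t. \<Sum>i\<in>I. f i t)"
  using assms
  by (induction I rule: infinite_finite_induct) (auto intro: primitive_on_const primitive_on_add)

text \<open>Integration by parts: once the initial values are subtracted, both factors are integrals
  from \<open>0\<close>, and \<open>integral_product_triangles\<close> evaluates their
  product.\<close>

lemma primitive_on_mult:
  assumes F: "primitive_on T F f" and G: "primitive_on T G g"
  shows "primitive_on T (\<lambda>t. F t * G t) (\<lambda>t. f t * G t + F t * g t)"
proof -
  \<comment> \<open>Cutting the densities off outside \<open>{0..t}\<close> turns integrals over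
    \<open>{0..s}\<close> into the half-line integrals of
    \<open>integral_product_triangles\<close>.\<close>
  have F_eq: "F s = F 0 + (LINT r:{..s}|lborel. indicator {0..t} r *\<^sub>R f r)"
    and G_eq: "G s = G 0 + (LINT r:{..s}|lborel. indicator {0..t} r *\<^sub>R g r)"
    if "s \<in> {0..t}" "t \<in> {0..T}" for s t
  proof -
    have i: "indicator {..s} r *\<^sub>R (indicator {0..t} r *\<^sub>R h r) = indicator {0..s} r *\<^sub>R h r"
      for r and h :: "real \<Rightarrow> real"
      using that by (auto simp: indicator_def)
    have s: "s \<in> {0..T}" using that by auto
    show "F s = F 0 + (LINT r:{..s}|lborel. indicator {0..t} r *\<^sub>R f r)"
      "G s = G 0 + (LINT r:{..s}|lborel. indicator {0..t} r *\<^sub>R g r)"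
      using primitive_onD(2)[OF F s] primitive_onD(2)[OF G s] unfolding set_lebesgue_integral_def i by auto
  qed
  have main: "set_integrable lborel {0..t} (\<lambda>s. f s * G s + F s * g s) \<and>
      F t * G t = F 0 * G 0 + (LINT s:{0..t}|lborel. f s * G s + F s * g s)" if t: "t \<in> {0..T}" for t
  proof -
    define f0 g0 where "f0 s = indicator {0..t} s *\<^sub>R f s" and "g0 s = indicator {0..t} s *\<^sub>R g s" for s
    have int: "integrable lborel f0" "integrable lborel g0"
      using primitive_onD(1)[OF F t] primitive_onD(1)[OF G t]
      by (simp_all add: set_integrable_def f0_def[abs_def] g0_def[abs_def])
    have Fg: "(LINT r:{..s}|lborel. f0 r) * g0 s = indicator {0..t} s *\<^sub>R ((F s - F 0) * g s)" for s
      using F_eq[of s t] t by (auto simp: f0_def[abs_def] g0_def indicator_def)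
    have fG: "(LINT r:{..s}|lborel. g0 r) * f0 s = indicator {0..t} s *\<^sub>R (f s * (G s - G 0))" for s
      using G_eq[of s t] t by (auto simp: g0_def[abs_def] f0_def indicator_def)
    have iFg: "integrable lborel (\<lambda>s. indicator {0..t} s *\<^sub>R ((F s - F 0) * g s))"
      using integral_product_triangles(1)[OF int] by (simp add: Fg)
    have ifG: "integrable lborel (\<lambda>s. indicator {0..t} s *\<^sub>R (f s * (G s - G 0)))"
      using integral_product_triangles(1)[OF int(2,1)] by (simp add: fG)
    have split: "indicator {0..t} s *\<^sub>R (f s * G s + F s * g s) =
        indicator {0..t} s *\<^sub>R ((F s - F 0) * g s) + indicator {0..t} s *\<^sub>R (f s * (G s - G 0))
        + (F 0 * g0 s + G 0 * f0 s)" for s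
      by (simp add: f0_def g0_def algebra_simps)
    have "(\<integral>s. indicator {0..t} s *\<^sub>R ((F s - F 0) * g s) \<partial>lborel)
        + (\<integral>s. indicator {0..t} s *\<^sub>R (f s * (G s - G 0)) \<partial>lborel) = (\<integral>s. f0 s \<partial>lborel) * (\<integral>s. g0 s \<partial>lborel)"
      using integral_product_triangles(2)[OF int] by (simp only: Fg fG[unfolded mult.commute[of _ "f0 _"]])
    moreover have "F t = F 0 + (\<integral>s. f0 s \<partial>lborel)" "G t = G 0 + (\<integral>s. g0 s \<partial>lborel)"
      using primitive_onD(2)[OF F t] primitive_onD(2)[OF G t]
      by (simp_all add: set_lebesgue_integral_def f0_def g0_def)
    moreover have "(\<integral>s. indicator {0..t} s *\<^sub>R (f s * G s + F s * g s) \<partial>lborel) =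
        (\<integral>s. indicator {0..t} s *\<^sub>R ((F s - F 0) * g s) \<partial>lborel)
        + (\<integral>s. indicator {0..t} s *\<^sub>R (f s * (G s - G 0)) \<partial>lborel)
        + (F 0 * (\<integral>s. g0 s \<partial>lborel) + G 0 * (\<integral>s. f0 s \<partial>lborel))"
      unfolding split using iFg ifG int by simp
    moreover have "integrable lborel (\<lambda>s. indicator {0..t} s *\<^sub>R (f s * G s + F s * g s))"
      unfolding split using iFg ifG int by simp
    ultimately show ?thesis
      by (simp only: set_integrable_def set_lebesgue_integral_def) (simp add: algebra_simps)
  qed
  show ?thesis
    by (rule primitive_onI) (use main in blast)+
qed

lemma primitive_on_C1:
  assumes "\<And>t. t \<in> {0..T} \<Longrightarrow> (F has_vector_derivative f t) (at t within {0..T})"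
    and "continuous_on {0..T} f"
  shows "primitive_on T F f"
proof (rule primitive_onI)
  fix t assume t: "t \<in> {0..T}"
  then show "set_integrable lborel {0..t} f"
    by (intro borel_integrable_atLeastAtMost' continuous_on_subset[OF assms(2)]) auto
  then have "(LINT s:{0..t}|lborel. f s) = integral {0..t} f"
    by (rule set_borel_integral_eq_integral)
  also have "\<dots> = F t - F 0"
    using t by (intro integral_unique fundamental_theorem_of_calculus
        has_vector_derivative_within_subset[OF assms(1)]) auto
  finally show "F t = F 0 + (LINT s:{0..t}|lborel. f s)" by simp
qed

lemma primitive_on_continuous:
  assumes "primitive_on T F f"
  shows "continuous_on {0..T} F"
proof -
  have "f integrable_on {0..T}"
    using assms by (intro set_borel_integral_eq_integral) (simp add: primitive_on_def)
  then have "continuous_on {0..T} (\<lambda>t. F 0 + integral {0..t} f)"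
    by (intro continuous_intros indefinite_integral_continuous_1)
  moreover have "F t = F 0 + integral {0..t} f" if "t \<in> {0..T}" for t
    using primitive_onD[OF assms that] set_borel_integral_eq_integral(2)[of "{0..t}" f] by simp
  ultimately show ?thesis by (metis (no_types, lifting) continuous_on_cong)
qed

lemma primitive_on_quadratic_form:
  fixes \<gamma> \<gamma>' :: "real \<Rightarrow> real^'n" and K K' :: "real \<Rightarrow> real^'n^'n"
  assumes \<gamma>: "\<And>i. primitive_on T (\<lambda>t. \<gamma> t $ i) (\<lambda>t. \<gamma>' t $ i)"
    and K: "\<And>t. t \<in> {0..T} \<Longrightarrow> (K has_vector_derivative K' t) (at t within {0..T})"
    and K': "continuous_on {0..T} K'"
  shows "primitive_on T (\<lambda>t. \<gamma> t \<bullet> (K t *v \<gamma> t))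
    (\<lambda>t. \<gamma>' t \<bullet> (K t *v \<gamma> t) + \<gamma> t \<bullet> (K' t *v \<gamma> t + K t *v \<gamma>' t))"
proof -
  have "primitive_on T (\<lambda>t. K t $ i $ j) (\<lambda>t. K' t $ i $ j)" for i j
    using K K' by (intro primitive_on_C1 has_vector_derivative_vec_nth continuous_on_component) auto
  then have "primitive_on T (\<lambda>t. \<Sum>i\<in>UNIV. \<gamma> t $ i * (\<Sum>j\<in>UNIV. K t $ i $ j * \<gamma> t $ j))
      (\<lambda>t. \<Sum>i\<in>UNIV. \<gamma>' t $ i * (\<Sum>j\<in>UNIV. K t $ i $ j * \<gamma> t $ j)
        + \<gamma> t $ i * (\<Sum>j\<in>UNIV. K' t $ i $ j * \<gamma> t $ j + K t $ i $ j * \<gamma>' t $ j))"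
    by (intro primitive_on_sum primitive_on_mult \<gamma>)
  then show ?thesis
    by (simp add: inner_vec_def matrix_vector_mult_def sum.distrib)
qed

section \<open>The LQ cost\<close>

lemma set_borel_measurable_iff:
  fixes u :: "real \<Rightarrow> 'a::{second_countable_topology, real_normed_vector}"
  shows "set_borel_measurable lborel {a..b} u \<longleftrightarrow> (\<lambda>t. indicator {a..b} t *\<^sub>R u t) \<in> borel_measurable borel"
  by (simp add: set_borel_measurable_def)

lemma admissible_primitive_on:
  assumes "(u, \<gamma>) \<in> admissible A B T x y"
  shows "primitive_on T (\<lambda>t. \<gamma> t $ i) (\<lambda>t. (A *v \<gamma> t + B *v u t) $ i)"
proof (rule primitive_onI)
  fix t assume t: "t \<in> {0..T}"
  have "set_integrable lborel {0..t} (\<lambda>t. A *v \<gamma> t + B *v u t)"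
    by (rule set_integrable_subset[of _ "{0..T}"]) (use assms t in \<open>auto simp: admissible_def\<close>)
  then have int: "integrable lborel (\<lambda>s. indicator {0..t} s *\<^sub>R (A *v \<gamma> s + B *v u s))"
    by (simp add: set_integrable_def)
  show "set_integrable lborel {0..t} (\<lambda>t. (A *v \<gamma> t + B *v u t) $ i)"
    using integrable_bounded_linear[OF bounded_linear_vec_nth int, of i]
    by (simp add: set_integrable_def)
  have "\<gamma> t = \<gamma> 0 + (LINT s:{0..t}|lborel. A *v \<gamma> s + B *v u s)"
    using assms t unfolding admissible_def by auto
  from arg_cong[OF this, of "\<lambda>v. v $ i"]
  show "\<gamma> t $ i = \<gamma> 0 $ i + (LINT s:{0..t}|lborel. (A *v \<gamma> s + B *v u s) $ i)"
    using integral_bounded_linear[OF bounded_linear_vec_nth int, of i]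
    by (simp add: set_lebesgue_integral_def)
qed

lemma admissible_continuous:
  assumes "(u, \<gamma>) \<in> admissible A B T x y"
  shows "continuous_on {0..T} \<gamma>"
proof -
  have "continuous_on {0..T} (\<lambda>t. \<chi> i. \<gamma> t $ i)"
    by (intro continuous_on_vec_lambda primitive_on_continuous[OF admissible_primitive_on[OF assms]])
  then show ?thesis by simp
qed

lemma admissible_integrable:
  assumes adm: "(u, \<gamma>) \<in> admissible A B T x y"
  shows "set_integrable lborel {0..T} (\<lambda>t. (norm (u t))\<^sup>2)"
    and "set_integrable lborel {0..T} (\<lambda>t. \<gamma> t \<bullet> (Q *v \<gamma> t))"
    and "set_integrable lborel {0..T} (\<lambda>t. (norm (u t))\<^sup>2 - \<gamma> t \<bullet> (Q *v \<gamma> t))"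
proof -
  show u: "set_integrable lborel {0..T} (\<lambda>t. (norm (u t))\<^sup>2)"
    using adm by (simp add: admissible_def)
  show \<gamma>: "set_integrable lborel {0..T} (\<lambda>t. \<gamma> t \<bullet> (Q *v \<gamma> t))"
    by (intro borel_integrable_atLeastAtMost' continuous_intros admissible_continuous[OF adm]
        bounded_linear.continuous_on[OF matrix_vector_mul_bounded_linear])
  show "set_integrable lborel {0..T} (\<lambda>t. (norm (u t))\<^sup>2 - \<gamma> t \<bullet> (Q *v \<gamma> t))"
    using u \<gamma> by (rule set_integral_diff)
qed

text \<open>The dynamics are linear in control and trajectory together. Square integrability of the
  combined control comes from the parallelogram identity.\<close>

lemma admissible_add_scaled:
  assumes u: "(u, \<gamma>) \<in> admissible A B T x y" and v: "(v, \<eta>) \<in> admissible A B T x' y'"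
  shows "((\<lambda>t. u t + c *\<^sub>R v t), (\<lambda>t. \<gamma> t + c *\<^sub>R \<eta> t)) \<in> admissible A B T (x + c *\<^sub>R x') (y + c *\<^sub>R y')"
proof -
  have meas: "set_borel_measurable lborel {0..T} (\<lambda>t. u t + c *\<^sub>R v t)"
  proof -
    have [measurable]: "(\<lambda>t. indicator {0..T} t *\<^sub>R u t) \<in> borel_measurable borel"
      "(\<lambda>t. indicator {0..T} t *\<^sub>R v t) \<in> borel_measurable borel"
      using u v by (simp_all add: admissible_def set_borel_measurable_iff)
    have "(\<lambda>t. indicator {0..T} t *\<^sub>R u t + c *\<^sub>R (indicator {0..T} t *\<^sub>R v t)) \<in> borel_measurable borel"
      by measurable
    then show ?thesis by (simp add: set_borel_measurable_iff scaleR_add_right mult.commute)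
  qed
  have sq: "set_integrable lborel {0..T} (\<lambda>t. (norm (u t + c *\<^sub>R v t))\<^sup>2)"
  proof (rule set_integrable_bound)
    show "set_integrable lborel {0..T} (\<lambda>t. 2 * (norm (u t))\<^sup>2 + (2 * c\<^sup>2) * (norm (v t))\<^sup>2)"
      using admissible_integrable(1)[OF u] admissible_integrable(1)[OF v] by simp
    have "(\<lambda>t. (norm (indicator {0..T} t *\<^sub>R (u t + c *\<^sub>R v t)))\<^sup>2) \<in> borel_measurable borel"
      using meas unfolding set_borel_measurable_iff by measurable
    moreover have "(\<lambda>t. indicator {0..T} t *\<^sub>R (norm (u t + c *\<^sub>R v t))\<^sup>2) =
        (\<lambda>t. (norm (indicator {0..T} t *\<^sub>R (u t + c *\<^sub>R v t)))\<^sup>2)"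
      by (auto simp: indicator_def)
    ultimately show "set_borel_measurable lborel {0..T} (\<lambda>t. (norm (u t + c *\<^sub>R v t))\<^sup>2)"
      by (simp only: set_borel_measurable_iff)
    show "AE t in lborel. t \<in> {0..T} \<longrightarrow>
        norm ((norm (u t + c *\<^sub>R v t))\<^sup>2) \<le> norm (2 * (norm (u t))\<^sup>2 + (2 * c\<^sup>2) * (norm (v t))\<^sup>2)"
    proof (rule AE_I2, rule impI)
      fix t
      have "(norm (u t + c *\<^sub>R v t))\<^sup>2 = 2 * (norm (u t))\<^sup>2 + (2 * c\<^sup>2) * (norm (v t))\<^sup>2 - (norm (u t - c *\<^sub>R v t))\<^sup>2"
        by (simp add: power2_norm_eq_inner inner_add_left inner_add_right inner_diff_left
            inner_diff_right inner_commute power2_eq_square[of c])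
      then have "(norm (u t + c *\<^sub>R v t))\<^sup>2 \<le> 2 * (norm (u t))\<^sup>2 + (2 * c\<^sup>2) * (norm (v t))\<^sup>2"
        using zero_le_power2[of "norm (u t - c *\<^sub>R v t)"] by linarith
      then show "norm ((norm (u t + c *\<^sub>R v t))\<^sup>2) \<le> norm (2 * (norm (u t))\<^sup>2 + (2 * c\<^sup>2) * (norm (v t))\<^sup>2)"
        by (simp only: real_norm_def abs_power2)
    qed
  qed
  have dyn: "A *v (\<gamma> t + c *\<^sub>R \<eta> t) + B *v (u t + c *\<^sub>R v t)
      = (A *v \<gamma> t + B *v u t) + c *\<^sub>R (A *v \<eta> t + B *v v t)" for t
    by (simp add: matrix_vector_right_distrib matrix_vector_mult_scaleR scaleR_add_right)
  have iu: "set_integrable lborel {0..T} (\<lambda>t. A *v \<gamma> t + B *v u t)"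
    and iv: "set_integrable lborel {0..T} (\<lambda>t. A *v \<eta> t + B *v v t)"
    using u v by (simp_all add: admissible_def)
  have traj: "\<gamma> t + c *\<^sub>R \<eta> t = (x + c *\<^sub>R x') + (LINT s:{0..t}|lborel. (A *v \<gamma> s + B *v u s) + c *\<^sub>R (A *v \<eta> s + B *v v s))"
    if t: "t \<in> {0..T}" for t
  proof -
    have su: "set_integrable lborel {0..t} (\<lambda>t. A *v \<gamma> t + B *v u t)"
      by (rule set_integrable_subset[OF iu]) (use t in auto)
    have sv: "set_integrable lborel {0..t} (\<lambda>t. A *v \<eta> t + B *v v t)"
      by (rule set_integrable_subset[OF iv]) (use t in auto)
    have "\<gamma> t = x + (LINT s:{0..t}|lborel. A *v \<gamma> s + B *v u s)"
      "\<eta> t = x' + (LINT s:{0..t}|lborel. A *v \<eta> s + B *v v s)"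
      using u v t unfolding admissible_def by blast+
    moreover have "(LINT s:{0..t}|lborel. (A *v \<gamma> s + B *v u s) + c *\<^sub>R (A *v \<eta> s + B *v v s))
        = (LINT s:{0..t}|lborel. A *v \<gamma> s + B *v u s) + c *\<^sub>R (LINT s:{0..t}|lborel. A *v \<eta> s + B *v v s)"
      unfolding set_integral_scaleR_right[symmetric]
      by (rule set_integral_add(2)[OF su set_integrable_scaleR_right[OF sv]])
    ultimately show ?thesis
      by (simp only: scaleR_add_right[of c x'] add_ac)
  qed
  have "set_integrable lborel {0..T} (\<lambda>t. (A *v \<gamma> t + B *v u t) + c *\<^sub>R (A *v \<eta> t + B *v v t))"
    using iu iv by simp
  moreover have "\<gamma> 0 = x" "\<gamma> T = y" "\<eta> 0 = x'" "\<eta> T = y'"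
    using u v by (auto simp: admissible_def)
  ultimately show ?thesis
    unfolding admissible_def using meas sq traj by (simp add: dyn)
qed

text \<open>The functional is a quadratic form in the pair of control and trajectory; admissibility
  of sum and difference makes all the integrals finite.\<close>

lemma LQ_functional_parallelogram:
  fixes u v :: "real \<Rightarrow> real^'m" and \<gamma> \<eta> :: "real \<Rightarrow> real^'n"
  assumes u: "(u, \<gamma>) \<in> admissible A B T x y" and v: "(v, \<eta>) \<in> admissible A B T x' y'"
  shows "LQ_functional Q T (\<lambda>t. u t + v t) (\<lambda>t. \<gamma> t + \<eta> t) + LQ_functional Q T (\<lambda>t. u t - v t) (\<lambda>t. \<gamma> t - \<eta> t)
    = 2 * LQ_functional Q T u \<gamma> + 2 * LQ_functional Q T v \<eta>"
proof -
  define q where "q u \<gamma> t = (norm (u t))\<^sup>2 - \<gamma> t \<bullet> (Q *v \<gamma> t)" for u :: "real \<Rightarrow> real^'m" and \<gamma> :: "real \<Rightarrow> real^'n" and t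
  have plus: "set_integrable lborel {0..T} (q (\<lambda>t. u t + v t) (\<lambda>t. \<gamma> t + \<eta> t))"
    using admissible_integrable(3)[OF admissible_add_scaled[OF u v, of 1], of Q] by (simp add: q_def[abs_def])
  have minus: "set_integrable lborel {0..T} (q (\<lambda>t. u t - v t) (\<lambda>t. \<gamma> t - \<eta> t))"
    using admissible_integrable(3)[OF admissible_add_scaled[OF u v, of "-1"], of Q] by (simp add: q_def[abs_def])
  have iu: "set_integrable lborel {0..T} (q u \<gamma>)" and iv: "set_integrable lborel {0..T} (q v \<eta>)"
    using admissible_integrable(3)[OF u, of Q] admissible_integrable(3)[OF v, of Q] by (simp_all add: q_def[abs_def])
  have pt: "q (\<lambda>t. u t + v t) (\<lambda>t. \<gamma> t + \<eta> t) t + q (\<lambda>t. u t - v t) (\<lambda>t. \<gamma> t - \<eta> t) t = 2 * q u \<gamma> t + 2 * q v \<eta> t" for t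
    by (simp add: q_def power2_norm_eq_inner matrix_vector_right_distrib matrix_vector_mult_diff_distrib
        inner_add_left inner_add_right inner_diff_left inner_diff_right inner_commute)
  have "(LINT t:{0..T}|lborel. q (\<lambda>t. u t + v t) (\<lambda>t. \<gamma> t + \<eta> t) t) + (LINT t:{0..T}|lborel. q (\<lambda>t. u t - v t) (\<lambda>t. \<gamma> t - \<eta> t) t)
      = (LINT t:{0..T}|lborel. 2 * q u \<gamma> t + 2 * q v \<eta> t)"
    unfolding set_integral_add(2)[OF plus minus, symmetric] pt ..
  also have "\<dots> = 2 * (LINT t:{0..T}|lborel. q u \<gamma> t) + 2 * (LINT t:{0..T}|lborel. q v \<eta> t)"
    using iu iv by simp
  finally show ?thesis by (simp add: LQ_functional_def q_def)
qed

context lq_system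
begin

text \<open>Completing the square with a Riccati solution.\<close>
lemma LQ_functional_ge_riccati:
  assumes reg: "\<And>t. 0 \<le> t \<Longrightarrow> t \<le> T \<Longrightarrow> det (riccati_denominator d t) \<noteq> 0" and T: "0 \<le> T"
    and adm: "(u, \<gamma>) \<in> admissible A B T x y"
  shows "(y \<bullet> (riccati d T *v y) - x \<bullet> (riccati d 0 *v x)) / 2 \<le> LQ_functional Q T u \<gamma>"
proof -
  interpret mm: bounded_bilinear "(**) :: real^'n^'n \<Rightarrow> real^'n^'n \<Rightarrow> real^'n^'n"
    by (rule bounded_bilinear_matrix_matrix_mult)
  let ?K = "riccati d"
  define K' where "K' t = - (transpose A ** ?K t) - ?K t ** A - Q - ?K t ** (B ** transpose B) ** ?K t" for t
  have K: "(?K has_vector_derivative K' t) (at t within {0..T})" if "t \<in> {0..T}" for t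
    unfolding K'_def using reg that by (intro riccati_has_vector_derivative) auto
  have "continuous_on {0..T} ?K"
    unfolding continuous_on_eq_continuous_within using has_vector_derivative_continuous[OF K] by blast
  then have K'_cont: "continuous_on {0..T} K'"
    unfolding K'_def[abs_def] by (intro continuous_intros mm.continuous_on)
  let ?g' = "\<lambda>t. A *v \<gamma> t + B *v u t"
  define D where "D t = ?g' t \<bullet> (?K t *v \<gamma> t) + \<gamma> t \<bullet> (K' t *v \<gamma> t + ?K t *v ?g' t)" for t
  have prim: "primitive_on T (\<lambda>t. \<gamma> t \<bullet> (?K t *v \<gamma> t)) D"
    unfolding D_def by (rule primitive_on_quadratic_form[OF admissible_primitive_on[OF adm] K K'_cont])
  \<comment> \<open>The Riccati equation cancels the terms with \<open>A\<close>, and its quadratic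
    term completes the square in the control.\<close>
  have square: "D t = (norm (u t))\<^sup>2 - \<gamma> t \<bullet> (Q *v \<gamma> t) - (norm (u t - transpose B *v (?K t *v \<gamma> t)))\<^sup>2"
    if t: "t \<in> {0..T}" for t
  proof -
    define k where "k = ?K t *v \<gamma> t"
    have sym: "v \<bullet> (?K t *v w) = (?K t *v v) \<bullet> w" for v w
      using riccati_symmetric[of d t] reg[of t] t inner_matrix_vector_mult[of "?K t" v w] by simp
    have "\<gamma> t \<bullet> (K' t *v \<gamma> t) = - 2 * (k \<bullet> (A *v \<gamma> t)) - \<gamma> t \<bullet> (Q *v \<gamma> t) - k \<bullet> (B *v (transpose B *v k))"
      by (simp add: K'_def matrix_vector_mult_diff_rdistrib matrix_minus_vector_mult inner_diff_right
          sym k_def[symmetric] flip: matrix_vector_mul_assoc)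
        (simp add: inner_commute flip: dot_lmul_matrix)
    moreover have "\<gamma> t \<bullet> (?K t *v ?g' t) = k \<bullet> ?g' t" unfolding sym k_def ..
    ultimately have "D t = 2 * (k \<bullet> (B *v u t)) - \<gamma> t \<bullet> (Q *v \<gamma> t) - k \<bullet> (B *v (transpose B *v k))"
      by (simp add: D_def k_def[symmetric] inner_add_left inner_add_right inner_commute)
    also have "\<dots> = (norm (u t))\<^sup>2 - \<gamma> t \<bullet> (Q *v \<gamma> t) - (norm (u t - transpose B *v k))\<^sup>2"
      by (simp add: power2_norm_eq_inner inner_diff_left inner_diff_right inner_commute flip: dot_lmul_matrix)
    finally show ?thesis by (simp add: k_def)
  qed
  have D_int: "set_integrable lborel {0..T} D" using prim by (simp add: primitive_on_def)
  have "\<gamma> 0 = x" "\<gamma> T = y" using adm by (auto simp: admissible_def)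
  then have "y \<bullet> (?K T *v y) - x \<bullet> (?K 0 *v x) = (LINT t:{0..T}|lborel. D t)"
    using primitive_onD(2)[OF prim, of T] T by simp
  also have "\<dots> \<le> (LINT t:{0..T}|lborel. (norm (u t))\<^sup>2 - \<gamma> t \<bullet> (Q *v \<gamma> t))"
    by (rule set_integral_mono[OF D_int admissible_integrable(3)[OF adm]]) (simp add: square)
  finally show ?thesis by (simp add: LQ_functional_def)
qed

text \<open>With the control \<open>transpose B *v p\<close>, where \<open>p\<close> is the
  momentum, the state half of Hamilton's equations is the control system.\<close>

lemma extremal_admissible:
  "((\<lambda>t. transpose B *v fst (\<Phi> t z)), (\<lambda>t. snd (\<Phi> t z))) \<in> admissible A B T (snd z) (snd (\<Phi> T z))"
proof -
  have cont: "continuous_on S (\<lambda>t. fst (\<Phi> t z))" "continuous_on S (\<lambda>t. snd (\<Phi> t z))" for S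
    unfolding continuous_on_eq_continuous_within
    using has_vector_derivative_continuous momentum_has_vector_derivative state_has_vector_derivative
    by blast+
  note mc = bounded_linear.continuous_on[OF matrix_vector_mul_bounded_linear]
  have u: "continuous_on S (\<lambda>t. transpose B *v fst (\<Phi> t z))" for S
    by (intro mc cont)
  have f: "continuous_on S (\<lambda>t. A *v snd (\<Phi> t z) + B *v (transpose B *v fst (\<Phi> t z)))" for S
    by (intro continuous_intros mc cont)
  have "(\<lambda>t. transpose B *v fst (\<Phi> t z)) \<in> borel_measurable borel"
    by (rule borel_measurable_continuous_onI[OF u])
  then have "set_borel_measurable lborel {0..T} (\<lambda>t. transpose B *v fst (\<Phi> t z))"
    unfolding set_borel_measurable_iff by measurable
  moreover have "set_integrable lborel {0..T} (\<lambda>t. (norm (transpose B *v fst (\<Phi> t z)))\<^sup>2)"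
    by (intro borel_integrable_atLeastAtMost' continuous_intros u)
  moreover have "set_integrable lborel {0..t} (\<lambda>t. A *v snd (\<Phi> t z) + B *v (transpose B *v fst (\<Phi> t z)))" for t
    by (intro borel_integrable_atLeastAtMost' f)
  moreover have "snd (\<Phi> t z) = snd z + (LINT s:{0..t}|lborel. A *v snd (\<Phi> s z) + B *v (transpose B *v fst (\<Phi> s z)))"
    if "t \<in> {0..T}" for t
  proof -
    have "(LINT s:{0..t}|lborel. A *v snd (\<Phi> s z) + B *v (transpose B *v fst (\<Phi> s z)))
        = integral {0..t} (\<lambda>s. A *v snd (\<Phi> s z) + B *v (transpose B *v fst (\<Phi> s z)))"
      by (intro set_borel_integral_eq_integral borel_integrable_atLeastAtMost' f)
    also have "\<dots> = snd (\<Phi> t z) - snd (\<Phi> 0 z)"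
      using that state_has_vector_derivative[of z]
      by (intro integral_unique fundamental_theorem_of_calculus) (auto simp: add.commute)
    finally show ?thesis by simp
  qed
  ultimately show ?thesis
    unfolding admissible_def by (simp del: transpose_matrix_vector)
qed

text \<open>Along an extremal the integrand is the derivative of momentum times state, so only
  boundary values remain.\<close>

lemma LQ_functional_extremal:
  assumes "0 \<le> T"
  shows "LQ_functional Q T (\<lambda>t. transpose B *v fst (\<Phi> t z)) (\<lambda>t. snd (\<Phi> t z))
    = (fst (\<Phi> T z) \<bullet> snd (\<Phi> T z) - fst z \<bullet> snd z) / 2"
proof -
  let ?q = "\<lambda>t. (norm (transpose B *v fst (\<Phi> t z)))\<^sup>2 - snd (\<Phi> t z) \<bullet> (Q *v snd (\<Phi> t z))"
  have "((\<lambda>t. fst (\<Phi> t z) \<bullet> snd (\<Phi> t z)) has_real_derivative ?q t) (at t within S)" for t S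
    by (rule DERIV_cong[OF DERIV_at_of_inner_vector[OF momentum_has_vector_derivative state_has_vector_derivative]])
      (simp add: power2_norm_eq_inner inner_add_right inner_diff_left inner_diff_right inner_commute flip: dot_lmul_matrix)
  then have "(?q has_integral fst (\<Phi> T z) \<bullet> snd (\<Phi> T z) - fst (\<Phi> 0 z) \<bullet> snd (\<Phi> 0 z)) {0..T}"
    using assms by (intro fundamental_theorem_of_calculus)
      (auto simp flip: has_real_derivative_iff_has_vector_derivative)
  moreover have "(LINT t:{0..T}|lborel. ?q t) = integral {0..T} ?q"
    by (intro set_borel_integral_eq_integral admissible_integrable(3)[OF extremal_admissible])
  ultimately show ?thesis
    unfolding LQ_functional_def by (simp add: integral_unique)
qed

text \<open>The perturbing extremal ends at \<open>0\<close>, so both perturbed trajectories still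
  end at \<open>y\<close>. In the parallelogram identity the first-order terms drop out and the
  extremal contributes twice its own value.\<close>

lemma LQ_cost_semiconcave:
  assumes T: "0 < T" and nz: "\<And>r. 0 < r \<Longrightarrow> r \<le> T \<Longrightarrow> det (r3 r) \<noteq> 0"
  shows "LQ_cost A B Q T (x + h) y + LQ_cost A B Q T (x - h) y
    \<le> 2 * LQ_cost A B Q T x y + h \<bullet> (cost_hessian T *v h)"
proof -
  obtain d where reg: "\<And>t. 0 \<le> t \<Longrightarrow> t \<le> T \<Longrightarrow> 0 < det (riccati_denominator d t)"
    using regular_riccati_denominator[OF T nz] by blast
  define I where "I x = (INF p\<in>admissible A B T x y. ereal (LQ_functional Q T (fst p) (snd p)))" for x
  \<comment> \<open>\<open>real_of_ereal\<close> sends infinite values to \<open>0\<close>, so the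
    infimum must be shown finite: the Riccati bound holds it from below and one extremal joining
    \<open>x\<close> to \<open>y\<close> from above.\<close>
  have I: "I x = ereal (LQ_cost A B Q T x y)" for x
  proof -
    have "ereal ((y \<bullet> (riccati d T *v y) - x \<bullet> (riccati d 0 *v x)) / 2) \<le> I x"
      unfolding I_def
    proof (rule INF_greatest)
      fix p assume "p \<in> admissible A B T x y"
      then have "(y \<bullet> (riccati d T *v y) - x \<bullet> (riccati d 0 *v x)) / 2 \<le> LQ_functional Q T (fst p) (snd p)"
        using reg T by (intro LQ_functional_ge_riccati) force+
      then show "ereal ((y \<bullet> (riccati d T *v y) - x \<bullet> (riccati d 0 *v x)) / 2)
          \<le> ereal (LQ_functional Q T (fst p) (snd p))" by simp
    qed
    moreover have "\<exists>p. p \<in> admissible A B T x y"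
    proof -
      define p where "p = matrix_inv (r3 T) *v (y - r4 T *v x)"
      have "snd (\<Phi> T (p, x)) = y"
        using T nz[of T] by (simp add: flow_snd p_def matrix_inv_vector_right)
      then show ?thesis using extremal_admissible[of "(p, x)" T] by auto
    qed
    then obtain p where "p \<in> admissible A B T x y" by blast
    then have "I x \<le> ereal (LQ_functional Q T (fst p) (snd p))"
      unfolding I_def by (rule INF_lower)
    ultimately have "\<bar>I x\<bar> \<noteq> \<infinity>" by auto
    then show ?thesis by (simp add: LQ_cost_def I_def ereal_real)
  qed
  have le: "LQ_cost A B Q T x y \<le> LQ_functional Q T u \<gamma>" if "(u, \<gamma>) \<in> admissible A B T x y" for x u \<gamma>
    using INF_lower[OF that, of "\<lambda>p. ereal (LQ_functional Q T (fst p) (snd p))"] I[of x]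
    by (simp add: I_def)
  define z where "z = (- (cost_hessian T *v h), h)"
  define v \<eta> where "v t = transpose B *v fst (\<Phi> t z)" and "\<eta> t = snd (\<Phi> t z)" for t
  have "snd (\<Phi> T z) = 0"
    using flow_focusing[of T h] nz[of T] T by (simp add: z_def)
  then have v: "(v, \<eta>) \<in> admissible A B T h 0" and v_val: "LQ_functional Q T v \<eta> = h \<bullet> (cost_hessian T *v h) / 2"
    using extremal_admissible[of z T] LQ_functional_extremal[of T z] T
    by (simp_all add: v_def[abs_def] \<eta>_def[abs_def] z_def inner_commute del: transpose_matrix_vector)
  show ?thesis
  \<comment> \<open>A control that is optimal up to \<open>e / 2\<close> replaces a minimizer; the
    parallelogram identity doubles the error to \<open>e\<close>.\<close>
  proof (rule field_le_epsilon)
    fix e :: real assume "e > 0"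
    then have "I x < ereal (LQ_cost A B Q T x y + e / 2)" by (simp add: I)
    then obtain u \<gamma> where u: "(u, \<gamma>) \<in> admissible A B T x y"
      and u_val: "LQ_functional Q T u \<gamma> < LQ_cost A B Q T x y + e / 2"
      unfolding I_def INF_less_iff by auto
    have "LQ_cost A B Q T (x + h) y \<le> LQ_functional Q T (\<lambda>t. u t + v t) (\<lambda>t. \<gamma> t + \<eta> t)"
      using admissible_add_scaled[OF u v, of 1] by (intro le) simp
    moreover have "LQ_cost A B Q T (x - h) y \<le> LQ_functional Q T (\<lambda>t. u t - v t) (\<lambda>t. \<gamma> t - \<eta> t)"
      using admissible_add_scaled[OF u v, of "-1"] by (intro le) simp
    moreover note LQ_functional_parallelogram[OF u v, of Q] u_val v_val
    ultimately show "LQ_cost A B Q T (x + h) y + LQ_cost A B Q T (x - h) y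
        \<le> 2 * LQ_cost A B Q T x y + h \<bullet> (cost_hessian T *v h) + e"
      by simp
  qed
qed

end

section \<open>Second derivatives\<close>

lemma grad_inner:
  assumes "f differentiable (at y)"
  shows "grad f y \<bullet> u = frechet_derivative f (at y) u"
proof -
  have lin: "linear (frechet_derivative f (at y))"
    by (rule linear_frechet_derivative[OF assms])
  have "frechet_derivative f (at y) u = frechet_derivative f (at y) (\<Sum>i\<in>UNIV. u $ i *\<^sub>R axis i 1)"
    by (simp add: basis_expansion flip: scalar_mult_eq_scaleR)
  also have "\<dots> = (\<Sum>i\<in>UNIV. u $ i * frechet_derivative f (at y) (axis i 1))"
    by (simp add: linear_sum[OF lin] linear_scale[OF lin])
  finally show ?thesis by (simp add: inner_vec_def grad_def mult.commute)
qed

lemma directional_derivative: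
  assumes "f differentiable (at (y + r *\<^sub>R u))"
  shows "((\<lambda>r. f (y + r *\<^sub>R u)) has_real_derivative grad f (y + r *\<^sub>R u) \<bullet> u) (at r)"
proof -
  have "((\<lambda>r. y + r *\<^sub>R u) has_derivative (\<lambda>h. h *\<^sub>R u)) (at r)"
    by (auto intro!: derivative_eq_intros)
  moreover have "(f has_derivative frechet_derivative f (at (y + r *\<^sub>R u))) (at (y + r *\<^sub>R u))"
    using assms frechet_derivative_works by blast
  ultimately have "((\<lambda>r. f (y + r *\<^sub>R u)) has_derivative (\<lambda>h. frechet_derivative f (at (y + r *\<^sub>R u)) (h *\<^sub>R u))) (at r)"
    using has_derivative_compose by blast
  then show ?thesis
    by (simp add: has_real_derivative_iff_has_vector_derivative has_vector_derivative_def
        linear_scale[OF linear_frechet_derivative[OF assms]] flip: grad_inner[OF assms])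
qed

text \<open>The mean value theorem, applied along \<open>u\<close> to the increment of
  \<open>f\<close> in direction \<open>v\<close>, leaves a difference of two gradients. As the
  gradient is differentiable just at \<open>x\<close>, both are compared with its linearization
  there.\<close>

lemma second_difference:
  fixes f :: "real^'n \<Rightarrow> real"
  assumes U: "open U" "x \<in> U" and diff: "\<And>y. y \<in> U \<Longrightarrow> f differentiable (at y)"
    and G: "(grad f has_derivative G) (at x)" and e: "e > 0"
  shows "\<exists>s>0. \<forall>t. 0 < t \<longrightarrow> t < s \<longrightarrow>
    \<bar>f (x + t *\<^sub>R u + t *\<^sub>R v) - f (x + t *\<^sub>R u) - f (x + t *\<^sub>R v) + f x - t\<^sup>2 * (G v \<bullet> u)\<bar>
    \<le> e * t\<^sup>2"
proof -
  define m where "m = norm u + norm v + 1"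
  \<comment> \<open>Two gradient errors of size \<open>k * (t * m)\<close>, paired with
    \<open>u\<close> and multiplied by \<open>t\<close>, add up to at most
    \<open>e * t\<^sup>2\<close>.\<close>
  define k where "k = e / (2 * m * m)"
  have m: "m > 0" "norm u \<le> m"
    unfolding m_def using norm_ge_zero[of u] norm_ge_zero[of v] by linarith+
  then have k: "k > 0" "k * (2 * m * m) = e"
    using e by (auto simp: k_def)
  have linG: "linear G" using G by (rule has_derivative_linear)
  obtain d where d: "d > 0" "\<And>y. norm (y - x) < d \<Longrightarrow> norm (grad f y - grad f x - G (y - x)) \<le> k * norm (y - x)"
    using G k(1) unfolding has_derivative_at_alt by blast
  obtain \<rho> where \<rho>: "\<rho> > 0" "ball x \<rho> \<subseteq> U"
    using U open_contains_ball by blast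
  define s where "s = min d \<rho> / m"
  show ?thesis
  proof (intro exI[of _ s] conjI allI impI)
    show "s > 0" using d \<rho> m by (simp add: s_def)
    fix t :: real assume t: "0 < t" "t < s"
    have tm: "t * m < d" "t * m < \<rho>"
      using t m by (auto simp: s_def pos_less_divide_eq)
    have near: "norm (r *\<^sub>R u + q *\<^sub>R v) \<le> t * m" if "0 \<le> r" "r \<le> t" "0 \<le> q" "q \<le> t" for r q
    proof -
      have "norm (r *\<^sub>R u + q *\<^sub>R v) \<le> r * norm u + q * norm v"
        using that by (intro order_trans[OF norm_triangle_ineq]) simp
      also have "\<dots> \<le> t * norm u + t * norm v"
        using that by (intro add_mono mult_right_mono) auto
      also have "\<dots> \<le> t * m" using t by (simp add: m_def distrib_left)
      finally show ?thesis .
    qed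
    have dist_add: "dist x (x + w) = norm w" for w by (simp add: dist_norm)
    have inU: "x + (r *\<^sub>R u + q *\<^sub>R v) \<in> U" if "0 \<le> r" "r \<le> t" "0 \<le> q" "q \<le> t" for r q
    proof -
      have "dist x (x + (r *\<^sub>R u + q *\<^sub>R v)) < \<rho>"
        unfolding dist_add using near[OF that] tm by linarith
      then show ?thesis using \<rho>(2) by auto
    qed
    have err: "norm (grad f (x + (r *\<^sub>R u + q *\<^sub>R v)) - grad f x - G (r *\<^sub>R u + q *\<^sub>R v)) \<le> k * (t * m)"
      if "0 \<le> r" "r \<le> t" "0 \<le> q" "q \<le> t" for r q
    proof -
      have "norm (grad f (x + (r *\<^sub>R u + q *\<^sub>R v)) - grad f x - G (r *\<^sub>R u + q *\<^sub>R v))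
          \<le> k * norm (r *\<^sub>R u + q *\<^sub>R v)"
        using d(2)[of "x + (r *\<^sub>R u + q *\<^sub>R v)"] near[OF that] tm by simp
      also have "\<dots> \<le> k * (t * m)"
        using near[OF that] k by (intro mult_left_mono) auto
      finally show ?thesis .
    qed
    define \<phi> where "\<phi> r = f (x + t *\<^sub>R v + r *\<^sub>R u) - f (x + r *\<^sub>R u)" for r
    have "(\<phi> has_real_derivative (grad f (x + t *\<^sub>R v + r *\<^sub>R u) \<bullet> u - grad f (x + r *\<^sub>R u) \<bullet> u)) (at r)"
      if "0 \<le> r" "r \<le> t" for r
      unfolding \<phi>_def[abs_def] using inU[OF that, of t] inU[OF that, of 0] t
      by (intro DERIV_diff directional_derivative diff) (auto simp: algebra_simps)
    then obtain r where r: "0 < r" "r < t"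
      and mvt: "\<phi> t - \<phi> 0 = (t - 0) * (grad f (x + t *\<^sub>R v + r *\<^sub>R u) \<bullet> u - grad f (x + r *\<^sub>R u) \<bullet> u)"
      using MVT2[of 0 t \<phi> "\<lambda>r. grad f (x + t *\<^sub>R v + r *\<^sub>R u) \<bullet> u - grad f (x + r *\<^sub>R u) \<bullet> u"] t by blast
    define a b where "a = grad f (x + (r *\<^sub>R u + t *\<^sub>R v)) - grad f x - G (r *\<^sub>R u + t *\<^sub>R v)"
      and "b = grad f (x + r *\<^sub>R u) - grad f x - G (r *\<^sub>R u)"
    have ab: "norm a \<le> k * (t * m)" "norm b \<le> k * (t * m)"
      using err[of r t] err[of r 0] r t by (auto simp: a_def b_def)
    have grad_diff: "grad f (x + (r *\<^sub>R u + t *\<^sub>R v)) - grad f (x + r *\<^sub>R u) = t *\<^sub>R G v + (a - b)"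
      by (simp add: a_def b_def linear_add[OF linG] linear_scale[OF linG])
    have "x + t *\<^sub>R v + r *\<^sub>R u = x + (r *\<^sub>R u + t *\<^sub>R v)" by simp
    then have "\<phi> t - \<phi> 0 = t * ((t *\<^sub>R G v + (a - b)) \<bullet> u)"
      using mvt by (simp only: grad_diff diff_zero flip: inner_diff_left)
    then have "\<phi> t - \<phi> 0 - t\<^sup>2 * (G v \<bullet> u) = t * ((a - b) \<bullet> u)"
      by (simp add: inner_add_left power2_eq_square algebra_simps)
    moreover have "\<bar>(a - b) \<bullet> u\<bar> \<le> (k * (t * m) + k * (t * m)) * m"
    proof (rule order_trans[OF Cauchy_Schwarz_ineq2], rule mult_mono)
      show "norm (a - b) \<le> k * (t * m) + k * (t * m)"
        using norm_triangle_ineq4[of a b] ab by linarith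
    qed (use m k t in auto)
    then have "t * \<bar>(a - b) \<bullet> u\<bar> \<le> t * (t * e)"
      using t by (intro mult_left_mono) (auto simp: k(2)[symmetric] algebra_simps)
    ultimately have "\<bar>\<phi> t - \<phi> 0 - t\<^sup>2 * (G v \<bullet> u)\<bar> \<le> e * t\<^sup>2"
      using t by (simp add: abs_mult power2_eq_square mult_ac)
    moreover have "f (x + t *\<^sub>R u + t *\<^sub>R v) - f (x + t *\<^sub>R u) - f (x + t *\<^sub>R v) + f x = \<phi> t - \<phi> 0"
      unfolding \<phi>_def by (simp add: add.assoc add.commute[of "t *\<^sub>R u" "t *\<^sub>R v"])
    ultimately show "\<bar>f (x + t *\<^sub>R u + t *\<^sub>R v) - f (x + t *\<^sub>R u) - f (x + t *\<^sub>R v) + f x - t\<^sup>2 * (G v \<bullet> u)\<bar> \<le> e * t\<^sup>2"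
      by simp
  qed
qed

text \<open>The second difference is symmetric in \<open>u\<close> and \<open>v\<close>, while its
  leading term is given by \<open>G v \<bullet> u\<close> in one order and by
  \<open>G u \<bullet> v\<close> in the other.\<close>

lemma second_derivative_symmetric:
  fixes f :: "real^'n \<Rightarrow> real"
  assumes U: "open U" "x \<in> U" and diff: "\<And>y. y \<in> U \<Longrightarrow> f differentiable (at y)"
    and G: "(grad f has_derivative G) (at x)"
  shows "G v \<bullet> u = G u \<bullet> v"
proof -
  have "\<bar>G v \<bullet> u - G u \<bullet> v\<bar> \<le> e" if "e > 0" for e
  proof -
    have "e / 2 > 0" using that by simp
    note sd = second_difference[OF assms this]
    obtain s1 s2 where s: "s1 > 0" "s2 > 0"
      "\<And>t. 0 < t \<Longrightarrow> t < s1 \<Longrightarrow> \<bar>f (x + t *\<^sub>R u + t *\<^sub>R v) - f (x + t *\<^sub>R u) - f (x + t *\<^sub>R v) + f x - t\<^sup>2 * (G v \<bullet> u)\<bar> \<le> e / 2 * t\<^sup>2"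
      "\<And>t. 0 < t \<Longrightarrow> t < s2 \<Longrightarrow> \<bar>f (x + t *\<^sub>R v + t *\<^sub>R u) - f (x + t *\<^sub>R v) - f (x + t *\<^sub>R u) + f x - t\<^sup>2 * (G u \<bullet> v)\<bar> \<le> e / 2 * t\<^sup>2"
      using sd[of u v] sd[of v u] by blast
    define t where "t = min s1 s2 / 2"
    have t: "0 < t" "t < s1" "t < s2" using s by (auto simp: t_def)
    have swap: "x + t *\<^sub>R v + t *\<^sub>R u = x + t *\<^sub>R u + t *\<^sub>R v" by simp
    have "\<bar>t\<^sup>2 * (G v \<bullet> u) - t\<^sup>2 * (G u \<bullet> v)\<bar> \<le> e * t\<^sup>2"
      using s(3)[OF t(1,2)] s(4)[OF t(1,3), unfolded swap] by linarith
    moreover have "t\<^sup>2 * \<bar>G v \<bullet> u - G u \<bullet> v\<bar> = \<bar>t\<^sup>2 * (G v \<bullet> u) - t\<^sup>2 * (G u \<bullet> v)\<bar>"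
      by (simp only: abs_mult abs_power2 flip: right_diff_distrib)
    ultimately have "t\<^sup>2 * \<bar>G v \<bullet> u - G u \<bullet> v\<bar> \<le> t\<^sup>2 * e"
      by (simp add: mult.commute)
    then show ?thesis using t by (simp add: mult_le_cancel_left)
  qed
  then have "\<bar>G v \<bullet> u - G u \<bullet> v\<bar> \<le> 0" by (rule field_le_epsilon) simp
  then show ?thesis by simp
qed

text \<open>For the directions \<open>h\<close> and \<open>- h\<close> the mixed second difference
  is twice \<open>f x\<close> minus the two neighbouring values, which is the quantity bounded by
  \<open>semi\<close>.\<close>

lemma second_derivative_ge:
  fixes f :: "real^'n \<Rightarrow> real"
  assumes U: "open U" "x \<in> U" and diff: "\<And>y. y \<in> U \<Longrightarrow> f differentiable (at y)"
    and G: "(grad f has_derivative G) (at x)"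
    and semi: "\<And>t. x + t *\<^sub>R h \<in> U \<Longrightarrow> x - t *\<^sub>R h \<in> U \<Longrightarrow>
      2 * f x \<le> f (x + t *\<^sub>R h) + f (x - t *\<^sub>R h) + t\<^sup>2 * m"
  shows "0 \<le> G h \<bullet> h + m"
proof (rule field_le_epsilon)
  fix e :: real assume e: "e > 0"
  obtain s where s: "s > 0" "\<And>t. 0 < t \<Longrightarrow> t < s \<Longrightarrow>
      \<bar>f (x + t *\<^sub>R h + t *\<^sub>R (- h)) - f (x + t *\<^sub>R h) - f (x + t *\<^sub>R (- h)) + f x - t\<^sup>2 * (G (- h) \<bullet> h)\<bar> \<le> e * t\<^sup>2"
    using second_difference[OF U diff G e, of h "- h"] by blast
  have "\<forall>\<^sub>F t in at_right 0. x + t *\<^sub>R h \<in> U" "\<forall>\<^sub>F t in at_right 0. x - t *\<^sub>R h \<in> U"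
    by (rule topological_tendstoD[OF _ U(1)], auto intro!: tendsto_eq_intros simp: U)+
  moreover have "\<forall>\<^sub>F t in at_right 0. t < s" "\<forall>\<^sub>F t in at_right 0. (0::real) < t"
    using s by (auto simp: eventually_at_right_less eventually_at_right_field)
  ultimately have "\<forall>\<^sub>F t in at_right 0. x + t *\<^sub>R h \<in> U \<and> x - t *\<^sub>R h \<in> U \<and> t < s \<and> (0::real) < t"
    by eventually_elim simp
  then obtain t where t: "x + t *\<^sub>R h \<in> U" "x - t *\<^sub>R h \<in> U" "t < s" "0 < t"
    using eventually_happens'[of "at_right (0::real)"] by force
  have "G (- h) \<bullet> h = - (G h \<bullet> h)"
    by (simp add: linear_neg[OF has_derivative_linear[OF G]])
  then have "0 \<le> t\<^sup>2 * (G h \<bullet> h) + t\<^sup>2 * m + e * t\<^sup>2"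
    using semi[OF t(1,2)] s(2)[OF t(4,3)] by (simp add: abs_le_iff)
  then have "0 \<le> t\<^sup>2 * (G h \<bullet> h + m + e)"
    by (simp add: algebra_simps)
  then show "0 \<le> G h \<bullet> h + m + e"
    using t by (simp add: zero_le_mult_iff)
qed

text \<open>The supremum defining \<open>\<psi> x\<close> need not be attained, so near-maximizers are used.\<close>
lemma c_convex_semiconvex:
  fixes c :: "'a::ab_group_add \<Rightarrow> 'a \<Rightarrow> real"
  assumes conv: "c_convex c \<psi>"
    and fin: "\<bar>\<psi> x\<bar> \<noteq> \<infinity>" "\<bar>\<psi> (x + h)\<bar> \<noteq> \<infinity>" "\<bar>\<psi> (x - h)\<bar> \<noteq> \<infinity>"
    and c: "\<And>y. c (x + h) y + c (x - h) y \<le> 2 * c x y + m"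
  shows "2 * real_of_ereal (\<psi> x) \<le> real_of_ereal (\<psi> (x + h)) + real_of_ereal (\<psi> (x - h)) + m"
proof (rule field_le_epsilon)
  fix e :: real assume "e > 0"
  obtain \<zeta> where \<zeta>: "\<And>x. \<psi> x = (SUP y. \<zeta> y - ereal (c x y))"
    using conv unfolding c_convex_def by blast
  have "ereal (real_of_ereal (\<psi> x) - e / 2) < \<psi> x"
    using fin(1) \<open>e > 0\<close> by (cases "\<psi> x") auto
  then obtain y where y: "ereal (real_of_ereal (\<psi> x) - e / 2) < \<zeta> y - ereal (c x y)"
    unfolding \<zeta>[of x] less_SUP_iff by blast
  have le: "\<zeta> y - ereal (c z y) \<le> \<psi> z" for z
    unfolding \<zeta>[of z] by (rule SUP_upper) simp
  \<comment> \<open>The choice of \<open>y\<close> as a near-maximizer excludes the value minus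
    infinity, and finiteness of \<open>\<psi> x\<close> excludes plus infinity.\<close>
  obtain r where r: "\<zeta> y = ereal r"
    using y le[of x] fin(1) by (cases "\<zeta> y") auto
  have "real_of_ereal (\<psi> x) - e / 2 < r - c x y" using y r by simp
  moreover have "r - c (x + h) y \<le> real_of_ereal (\<psi> (x + h))"
    using le[of "x + h"] fin(2) r by (cases "\<psi> (x + h)") auto
  moreover have "r - c (x - h) y \<le> real_of_ereal (\<psi> (x - h))"
    using le[of "x - h"] fin(3) r by (cases "\<psi> (x - h)") auto
  ultimately show "2 * real_of_ereal (\<psi> x)
      \<le> real_of_ereal (\<psi> (x + h)) + real_of_ereal (\<psi> (x - h)) + m + e"
    using c[of y] by linarith
qed

section \<open>Concavity of the Jacobian determinant\<close>

text \<open>A vector on which a semidefinite form vanishes minimizes it, so the first-order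
  condition places the vector in the kernel.\<close>

lemma positive_definite_if_nonsingular:
  fixes M :: "real^'n^'n"
  assumes sym: "transpose M = M" and psd: "\<And>v. 0 \<le> v \<bullet> (M *v v)" and det: "det M \<noteq> 0" and v: "v \<noteq> 0"
  shows "0 < v \<bullet> (M *v v)"
proof (rule ccontr)
  assume "\<not> ?thesis"
  then have zero: "v \<bullet> (M *v v) = 0" using psd[of v] by simp
  have "w \<bullet> (M *v v) = 0" for w
  proof -
    have "2 * t * - (w \<bullet> (M *v v)) + t\<^sup>2 * - (w \<bullet> (M *v w)) \<le> 0" for t
      using psd[of "v + t *\<^sub>R w"] zero inner_matrix_vector_mult_symmetric[OF sym, of v w]
      by (simp add: matrix_vector_right_distrib matrix_vector_mult_scaleR inner_add_left
          inner_add_right power2_eq_square algebra_simps)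
    from linear_term_zero_if_quadratic_nonpos[OF this] show ?thesis by simp
  qed
  then have "M *v v = 0" by (metis inner_eq_zero_iff)
  then show False using matrix_inv_vector_left[OF det, of v] v by simp
qed

context lq_system
begin

text \<open>The Jacobian at time \<open>t\<close> factors as \<open>r3 t ** ((G + cost_hessian s) + (cost_hessian t - cost_hessian s))\<close>,
  a sum of two positive semidefinite matrices.\<close>
lemma jacobian_det_concave:
  fixes G :: "real^'n^'n"
  assumes Gsym: "transpose G = G"
    and G: "\<And>v. 0 \<le> v \<bullet> (G *v v) + v \<bullet> (cost_hessian T *v v)"
    and nz: "\<And>r. 0 < r \<Longrightarrow> r \<le> T \<Longrightarrow> det (r3 r) \<noteq> 0"
    and t: "0 < t" "t < s" "s \<le> T"
  defines "J \<equiv> \<lambda>t. r3 t ** G + r4 t"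
  shows "root CARD('n) (det (r3 (t - s))) / root CARD('n) (det (r3 (- s)))
      + root CARD('n) (det (r3 t)) / root CARD('n) (det (r3 s)) * root CARD('n) (det (J s))
      \<le> root CARD('n) (det (J t))"
    and "0 < root CARD('n) (det (r3 (t - s))) / root CARD('n) (det (r3 (- s)))"
proof -
  have T: "0 < T" using t by simp
  have pos: "0 < det (r3 r)" if "0 < r" "r \<le> T" for r
    using regular_riccati_denominator[OF T nz] that by blast
  define M where "M = cost_hessian t - cost_hessian s"
  define N where "N = G + cost_hessian s"
  note sym = inner_matrix_vector_mult_symmetric[OF cost_hessian_symmetric[OF nz]]
  have N_sym: "transpose N = N"
    using inner_matrix_vector_mult_symmetric[OF Gsym] sym[of s] t
    by (intro symmetric_matrixI) (simp add: N_def matrix_vector_mult_add_rdistrib inner_add_right)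
  have M_sym: "transpose M = M"
    using sym[of s] sym[of t] t
    by (intro symmetric_matrixI) (simp add: M_def matrix_vector_mult_diff_rdistrib inner_diff_right)
  \<comment> \<open>The cost hessian decreases in time, so replacing \<open>T\<close> by the earlier
    \<open>s\<close> only increases the form.\<close>
  have N_psd: "0 \<le> v \<bullet> (N *v v)" for v
    using G[of v] cost_hessian_antimono[of s T v] nz t
    by (simp add: N_def matrix_vector_mult_add_rdistrib inner_add_right)
  have M_psd: "0 \<le> v \<bullet> (M *v v)" for v
    using cost_hessian_antimono[of t s v] nz t
    by (simp add: M_def matrix_vector_mult_diff_rdistrib inner_diff_right)
  have J: "J r = r3 r ** (G + cost_hessian r)" if "0 < r" "r \<le> T" for r
    using r3_cost_hessian[OF nz[OF that]]
    by (simp add: J_def matrix_add_ldistrib) (simp add: matrix_eq flip: matrix_vector_mul_assoc)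
  have "r3 t ** M = r3 (t - s) ** matrix_inv (r3 (- s))"
  proof -
    have "r3 t ** M = r3 t ** cost_hessian t - r3 t ** cost_hessian s"
      by (simp add: M_def bounded_bilinear.diff_right[OF bounded_bilinear_matrix_matrix_mult])
    also have "r3 t ** cost_hessian t = r4 t"
      using r3_cost_hessian[OF nz] t by (simp add: matrix_eq flip: matrix_vector_mul_assoc)
    finally show ?thesis using r4_minus_r3_cost_hessian[of s t] nz[of s] t by simp
  qed
  moreover have "det (matrix_inv (r3 (- s))) = 1 / det (r3 (- s))"
  proof -
    have "det (r3 (- s)) \<noteq> 0" using nz[of s] t by (simp add: det_r3_minus)
    moreover from matrix_inv_left_mult[OF this]
    have "det (matrix_inv (r3 (- s))) * det (r3 (- s)) = 1" by (metis det_mul det_I)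
    ultimately show ?thesis by (simp add: eq_divide_eq)
  qed
  ultimately have det_M: "det (r3 t) * det M = det (r3 (t - s)) / det (r3 (- s))"
    by (metis det_mul times_divide_eq_right mult.right_neutral)
  \<comment> \<open>The times \<open>s - t\<close> and \<open>s\<close> both lie in
    \<open>{0<..T}\<close>, so \<open>M\<close> is nonsingular and hence definite, as
    \<open>minkowski_determinant\<close> requires of its first matrix.\<close>
  have "det (r3 (t - s)) \<noteq> 0"
    using nz[of "s - t"] det_r3_minus[of "s - t"] t by simp
  moreover have "det (r3 (- s)) \<noteq> 0" using nz[of s] t by (simp add: det_r3_minus)
  ultimately have "det M \<noteq> 0" using det_M by auto
  then have M_pd: "0 < v \<bullet> (M *v v)" if "v \<noteq> 0" for v
    using positive_definite_if_nonsingular[OF M_sym M_psd _ that] by simp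
  let ?root = "root CARD('n)"
  have "?root (det (r3 t)) > 0" using pos[of t] t by simp
  moreover have "?root (det M) + ?root (det N) \<le> ?root (det (M + N))"
    by (rule minkowski_determinant[OF M_sym N_sym M_pd N_psd])
  ultimately have "?root (det (r3 t)) * (?root (det M) + ?root (det N)) \<le> ?root (det (r3 t)) * ?root (det (M + N))"
    by simp
  moreover have "?root (det (J t)) = ?root (det (r3 t)) * ?root (det (M + N))"
    using t by (simp add: J M_def N_def det_mul real_root_mult add.commute)
  moreover have "?root (det (J s)) = ?root (det (r3 s)) * ?root (det N)"
    using t by (simp add: J N_def det_mul real_root_mult)
  moreover have "?root (det (r3 s)) \<noteq> 0" using pos[of s] t by simp
  moreover have M_eq: "?root (det (r3 (t - s))) / ?root (det (r3 (- s))) = ?root (det (r3 t)) * ?root (det M)"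
    by (simp add: det_M flip: real_root_mult real_root_divide)
  ultimately show "?root (det (r3 (t - s))) / ?root (det (r3 (- s)))
      + ?root (det (r3 t)) / ?root (det (r3 s)) * ?root (det (J s)) \<le> ?root (det (J t))"
    by (simp add: distrib_left)
  have "0 < det M" by (rule det_positive_definite[OF M_sym N_sym M_pd N_psd])
  then show "0 < ?root (det (r3 (t - s))) / ?root (det (r3 (- s)))"
    unfolding M_eq using pos[of t] t by simp
qed

text \<open>This gives the sign of the second term of the inequality. The case \<open>s = T\<close>
  is included, where \<open>G\<close> is controlled only by semidefiniteness, so the bound is not
  strict.\<close>

lemma jacobian_det_nonneg:
  fixes G :: "real^'n^'n"
  assumes Gsym: "transpose G = G"
    and G: "\<And>v. 0 \<le> v \<bullet> (G *v v) + v \<bullet> (cost_hessian T *v v)"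
    and nz: "\<And>r. 0 < r \<Longrightarrow> r \<le> T \<Longrightarrow> det (r3 r) \<noteq> 0"
    and s: "0 < s" "s \<le> T"
  shows "0 \<le> det (r3 s ** G + r4 s)"
proof -
  have "0 < T" using s by simp
  then have "0 < det (r3 s)"
    using regular_riccati_denominator[OF _ nz] s by blast
  define N where "N = G + cost_hessian s"
  have "transpose N = N"
    using inner_matrix_vector_mult_symmetric[OF Gsym]
      inner_matrix_vector_mult_symmetric[OF cost_hessian_symmetric[OF nz[OF s]]]
    by (intro symmetric_matrixI) (simp add: N_def matrix_vector_mult_add_rdistrib inner_add_right)
  moreover have "0 \<le> v \<bullet> (N *v v)" for v
    using G[of v] cost_hessian_antimono[of s T v] nz s
    by (simp add: N_def matrix_vector_mult_add_rdistrib inner_add_right)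
  \<comment> \<open>The identity matrix serves as the definite partner.\<close>
  ultimately have "0 \<le> det N"
    by (intro det_nonneg_semidefinite[of "mat 1"]) (auto simp: transpose_mat)
  moreover have "r3 s ** G + r4 s = r3 s ** N"
    using r3_cost_hessian[OF nz[OF s]]
    by (simp add: N_def matrix_add_ldistrib) (simp add: matrix_eq flip: matrix_vector_mul_assoc)
  ultimately show ?thesis using \<open>0 < det (r3 s)\<close> by (simp add: det_mul)
qed

end

theorem theorem5p2:
  fixes A :: "real^'n^'n" and B :: "real^'m^'n" and Q :: "real^'n^'n" and T :: real
    and \<mu> \<nu> :: "(real^'n) measure" and \<psi> :: "real^'n \<Rightarrow> ereal" and x :: "real^'n"
  defines "n \<equiv> CARD('n)"
  defines "Tm \<equiv> transport_map A B Q \<psi>"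
  defines "term1 \<equiv> (\<lambda>s \<tau>. root n (det (R3 A B Q (\<tau> - s))) / root n (det (R3 A B Q (- s))))"
  defines "term2 \<equiv> (\<lambda>s \<tau>. root n (det (R3 A B Q \<tau>)) / root n (det (R3 A B Q s))
                             * root n (det (jacobian (Tm s) (at x))))"
  assumes rankB: "rank B = CARD('m)"
    and Qsym: "transpose Q = Q"
    and kalman: "kalman_condition A B"
    and Tpos: "0 < T"
    and Tconj: "ereal T < first_conjugate_time A B Q"
    and \<mu>P2: "P2 \<mu>" and \<nu>P2: "P2 \<nu>"
    and \<mu>ac: "absolutely_continuous lborel \<mu>"
    and kant: "kantorovich_potential (LQ_cost A B Q T) \<mu> \<nu> \<psi>"
    and twice: "twice_differentiable_at \<psi> x"
  shows "(\<forall>\<tau>\<in>{0..T}. Tm \<tau> differentiable (at x)) \<and>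
         (\<forall>s\<in>{0<..T}. \<forall>\<tau>\<in>{0..s}.
             root n (det (jacobian (Tm \<tau>) (at x))) \<ge> term1 s \<tau> + term2 s \<tau> \<and>
             term1 s \<tau> \<ge> 0 \<and> term2 s \<tau> \<ge> 0 \<and> (\<tau> < s \<longrightarrow> term1 s \<tau> > 0)) \<and>
         (\<forall>\<tau>\<in>{0..<T}. det (jacobian (Tm \<tau>) (at x)) > 0)"
proof -
  interpret lq_system A Q B by standard (rule Qsym)
  \<comment> \<open>A zero of the determinant in this range would bound the first conjugate time by
    \<open>T\<close>.\<close>
  have nz: "det (r3 r) \<noteq> 0" if "0 < r" "r \<le> T" for r
  proof
    assume "det (r3 r) = 0"
    then have "first_conjugate_time A B Q \<le> ereal r"
      unfolding first_conjugate_time_def using that by (intro Inf_lower) auto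
    also have "ereal r \<le> ereal T" using that by simp
    finally show False using Tconj by simp
  qed
  have pos: "0 < det (r3 r)" if "0 < r" "r \<le> T" for r
    using regular_riccati_denominator[OF Tpos nz] that by blast
  define f where "f = (\<lambda>z. real_of_ereal (\<psi> z))"
  obtain U where U: "open U" "x \<in> U"
    and regular: "\<forall>y\<in>U. \<bar>\<psi> y\<bar> \<noteq> \<infinity> \<and> f differentiable (at y)"
    and grad_diff: "grad f differentiable (at x)"
    using twice unfolding twice_differentiable_at_def f_def by blast
  have fin: "\<bar>\<psi> y\<bar> \<noteq> \<infinity>" and diff: "f differentiable (at y)" if "y \<in> U" for y
    using regular that by auto
  define G where "G = matrix (frechet_derivative (grad f) (at x))"
  have grad_deriv: "(grad f has_derivative (\<lambda>h. G *v h)) (at x)"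
    using grad_diff frechet_derivative_works[of "grad f" "at x"]
      matrix_vector_mul(2)[OF linear_frechet_derivative[OF grad_diff]]
    by (simp add: G_def)
  have Gsym: "transpose G = G"
    using second_derivative_symmetric[OF U diff grad_deriv]
    by (intro symmetric_matrixI) (simp add: inner_commute)
  \<comment> \<open>Semiconcavity of the cost along \<open>t *\<^sub>R v\<close> becomes
    semiconvexity of \<open>\<psi>\<close> with the same quadratic modulus, and this bounds the
    Hessian from below.\<close>
  have G_ge: "0 \<le> v \<bullet> (G *v v) + v \<bullet> (cost_hessian T *v v)" for v
  proof -
    have "0 \<le> (G *v v) \<bullet> v + v \<bullet> (cost_hessian T *v v)"
    proof (rule second_derivative_ge[OF U diff grad_deriv])
      fix t assume "x + t *\<^sub>R v \<in> U" "x - t *\<^sub>R v \<in> U"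
      then show "2 * f x \<le> f (x + t *\<^sub>R v) + f (x - t *\<^sub>R v) + t\<^sup>2 * (v \<bullet> (cost_hessian T *v v))"
        unfolding f_def
        using LQ_cost_semiconcave[OF Tpos nz, where h = "t *\<^sub>R v"] kant fin U
        by (intro c_convex_semiconvex[where c = "LQ_cost A B Q T"])
          (auto simp: kantorovich_potential_def matrix_vector_mult_scaleR power2_eq_square mult.assoc)
    qed
    then show ?thesis by (simp add: inner_commute)
  qed
  define J where "J \<tau> = r3 \<tau> ** G + r4 \<tau>" for \<tau>
  have Tm_deriv: "(Tm \<tau> has_derivative (\<lambda>h. J \<tau> *v h)) (at x)" for \<tau>
  proof -
    note mv = bounded_linear.has_derivative[OF matrix_vector_mul_bounded_linear]
    have "((\<lambda>y. r3 \<tau> *v grad f y + r4 \<tau> *v y) has_derivative (\<lambda>h. r3 \<tau> *v (G *v h) + r4 \<tau> *v h)) (at x)"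
      by (intro has_derivative_add mv grad_deriv has_derivative_ident)
    then show ?thesis
      by (simp add: Tm_def transport_map_def[abs_def] LQ_exp_def J_def f_def
          matrix_vector_mult_add_rdistrib flip: matrix_vector_mul_assoc)
  qed
  have jac: "jacobian (Tm \<tau>) (at x) = J \<tau>" for \<tau>
    unfolding jacobian_def frechet_derivative_at[OF Tm_deriv, symmetric]
    by (rule matrix_of_matrix_vector_mul)
  have J_nonneg: "0 \<le> det (J s)" if "0 < s" "s \<le> T" for s
    unfolding J_def by (rule jacobian_det_nonneg[OF Gsym G_ge nz that])
  have main: "term1 s \<tau> + term2 s \<tau> \<le> root n (det (J \<tau>)) \<and> 0 \<le> term1 s \<tau> \<and> 0 \<le> term2 s \<tau> \<and> (\<tau> < s \<longrightarrow> 0 < term1 s \<tau>)"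
    if s: "0 < s" "s \<le> T" and \<tau>: "0 \<le> \<tau>" "\<tau> \<le> s" for s \<tau>
  proof -
    have n: "n > 0" by (simp add: n_def)
    \<comment> \<open>At \<open>\<tau> = 0\<close> the second term vanishes and at
      \<open>\<tau> = s\<close> the first one does. The inequality is an equality at both
      ends.\<close>
    have det_0: "det (r3 0) = 0"
      using matrix_inv_vector_left[of "r3 0" "axis undefined 1"] by (auto simp: axis_eq_0_iff)
    \<comment> \<open>For odd \<open>n\<close> the determinant at \<open>- s\<close> and its root
      are negative, so positivity can be asked only of the quotient \<open>term1\<close>.\<close>
    have root_s: "root n (det (r3 s)) > 0" "root n (det (r3 (- s))) \<noteq> 0"
      using pos[OF s] n det_r3_minus[of s] by auto
    have term2: "0 \<le> term2 s \<tau>"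
    proof -
      have "0 \<le> det (r3 \<tau>)" using pos[of \<tau>] \<tau> s det_0 by (cases "\<tau> = 0") auto
      then show ?thesis
        using root_s J_nonneg[OF s] n by (simp add: term2_def jac)
    qed
    consider "\<tau> = 0" | "0 < \<tau>" "\<tau> < s" | "0 < \<tau>" "\<tau> = s" using \<tau> by linarith
    then show ?thesis
    proof cases
      case 1
      then show ?thesis using root_s n det_0 by (simp add: term1_def term2_def J_def)
    next
      case 2
      have "term1 s \<tau> + term2 s \<tau> \<le> root n (det (J \<tau>))" "0 < term1 s \<tau>"
        using jacobian_det_concave[OF Gsym G_ge nz 2 s(2)]
        by (simp_all add: term1_def term2_def jac J_def n_def)
      then show ?thesis using term2 by simp
    next
      case 3
      then show ?thesis using term2 root_s det_0 by (simp add: term1_def term2_def jac)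
    qed
  qed
  \<comment> \<open>Taking \<open>s = T\<close> makes the first term strictly positive for every
    \<open>\<tau> < T\<close>, and the second is nonnegative.\<close>
  have "0 < det (J \<tau>)" if "0 \<le> \<tau>" "\<tau> < T" for \<tau>
  proof -
    have "0 < root n (det (J \<tau>))" using main[OF Tpos order_refl, of \<tau>] that by simp
    then show ?thesis by (simp add: n_def)
  qed
  moreover have "Tm \<tau> differentiable (at x)" for \<tau>
    using Tm_deriv unfolding differentiable_def by blast
  ultimately show ?thesis
    using main by (auto simp: jac)
qed

end
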